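(* Let $d\ge 2$ and let $\mathcal{T}$ be a simplex tree consisting only of simplices of dimension at most $n$, where $n < \frac{d+1}{2}$. Let $E \subset \mathbb{F}_q^d$ and put $s = n + \frac{d-1}{2}$. If $|E| \gtrsim q^s$, then $E$ contains a positive proportion of congruence classes of $\mathcal{T}$ in $\mathbb{F}_q^d$.
   Context: $q$ is a prime power, treated as an asymptotic parameter. For $x,y\in\mathbb{F}_q^d$, $\|x-y\| = \sum_{i=1}^d(x_i-y_i)^2$. $X\lesssim Y$ ($X \gtrsim Y$) means $X\le CY$ ($X\ge CY$) for a constant $C$ independent of $q$; a statement "if $|E|\gtrsim q^s$ then ..." means there are constants independent of $q$ and $E$ so that $|E|\ge Cq^s$ implies the conclusion with implied constants independent of $q$. For a finite graph $G$, an embedding is a map $p: V(G)\to\mathbb{F}_q^d$; embeddings $p,p'$ are congruent if $\|p(v_i)-p(v_j)\| = \|p'(v_i)-p'(v_j)\|$ for every edge $(v_i,v_j)$ of $G$; congruence classes are the equivalence classes. $E$ "contains a positive proportion of congruence classes of $G$" means the number of congruence classes of $G$ containing an embedding with image in $E$ is $\gtrsim$ the total number of congruence classes of $G$ in $\mathbb{F}_q^d$. A $k$-simplex is the complete graph on $k+1$ vertices (dimension $k$). A simplex tree is a finite set $\mathcal{T}=\{S_i: i\in I\}$ of simplices (the graph being their union) such that either $|\mathcal{T}|=1$, or: (1) distinct simplices share at most one vertex; (2) any two simplices are joined by a path of distinct simplices with consecutive ones sharing a vertex; (3) there is no closed cycle of $n\ge3$ distinct simplices with consecutive ones (and the last and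 first) sharing a vertex.
   Formalization: The formal statement assumes q odd. For even q, ‖x−y‖ = (Σ(x_i−y_i))² and the claim is false: for d ≥ 4, n = 1 and a single edge, the hyperplane Σx_i = 0 has q^{d−1} points but contains only one of q congruence classes. *)

theory Defs
  imports Complex_Main "HOL-Library.FuncSet" "HOL-Algebra.Ring"
begin

text \<open>
  The constants in the asymptotic statements must not depend on the field, so the finite fields
  have to be quantified over inside a formula. They are therefore HOL-Algebra rings with a
  carrier set. The type of the carrier elements is arbitrary; at an infinite type such as
  \<^typ>\<open>nat\<close> the fields of type \<^typ>\<open>nat ring\<close> include every finite field up to isomorphism.
\<close>

definition affine_space :: "'a ring \<Rightarrow> nat \<Rightarrow> (nat \<Rightarrow> 'a) set" where
  "affine_space F d = {..<d} \<rightarrow>\<^sub>E carrier F"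

definition sqdist :: "'a ring \<Rightarrow> nat \<Rightarrow> (nat \<Rightarrow> 'a) \<Rightarrow> (nat \<Rightarrow> 'a) \<Rightarrow> 'a" where
  "sqdist F d x y = (\<Oplus>\<^bsub>F\<^esub>i\<in>{..<d}. (x i \<ominus>\<^bsub>F\<^esub> y i) [^]\<^bsub>F\<^esub> (2::nat))"

text \<open>
  A graph is a pair of a vertex set and a symmetric, irreflexive set of edges. Embeddings need not
  be injective; they are extensional functions, so that they are determined by their values on
  the vertices.
\<close>

type_synonym 'v graph = "'v set \<times> ('v \<times> 'v) set"

definition embeddings :: "'a ring \<Rightarrow> nat \<Rightarrow> 'v graph \<Rightarrow> ('v \<Rightarrow> nat \<Rightarrow> 'a) set" where
  "embeddings F d G = fst G \<rightarrow>\<^sub>E affine_space F d"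

definition congruence ::
  "'a ring \<Rightarrow> nat \<Rightarrow> 'v graph \<Rightarrow> (('v \<Rightarrow> nat \<Rightarrow> 'a) \<times> ('v \<Rightarrow> nat \<Rightarrow> 'a)) set" where
  "congruence F d G =
     {(p, p'). p \<in> embeddings F d G \<and> p' \<in> embeddings F d G \<and>
               (\<forall>(u, v)\<in>snd G. sqdist F d (p u) (p v) = sqdist F d (p' u) (p' v))}"

lemma equiv_congruence: "equiv (embeddings F d G) (congruence F d G)"
  by (rule equivI) (fastforce simp: congruence_def refl_on_def sym_def trans_def)+

definition congruence_classes ::
  "'a ring \<Rightarrow> nat \<Rightarrow> 'v graph \<Rightarrow> ('v \<Rightarrow> nat \<Rightarrow> 'a) set set" where
  "congruence_classes F d G = embeddings F d G // congruence F d G"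

definition congruence_classes_in ::
  "'a ring \<Rightarrow> nat \<Rightarrow> 'v graph \<Rightarrow> (nat \<Rightarrow> 'a) set \<Rightarrow> ('v \<Rightarrow> nat \<Rightarrow> 'a) set set" where
  "congruence_classes_in F d G E =
     {c \<in> congruence_classes F d G. \<exists>p\<in>c. p ` fst G \<subseteq> E}"

text \<open>A simplex, being a complete graph, is represented by its vertex set.\<close>

definition is_simplex :: "nat \<Rightarrow> 'v set \<Rightarrow> bool" where
  "is_simplex k S \<longleftrightarrow> finite S \<and> card S = k + 1"

definition complete_graph :: "'v set \<Rightarrow> 'v graph" where
  "complete_graph S = (S, {(u, v). u \<in> S \<and> v \<in> S \<and> u \<noteq> v})"

definition union_graph :: "'v set set \<Rightarrow> 'v graph" where
  "union_graph T =
     ((\<Union>S\<in>T. fst (complete_graph S)), (\<Union>S\<in>T. snd (complete_graph S)))"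

definition simplex_walk :: "'v set set \<Rightarrow> 'v set list \<Rightarrow> bool" where
  "simplex_walk T Ss \<longleftrightarrow>
     Ss \<noteq> [] \<and> set Ss \<subseteq> T \<and> distinct Ss \<and> successively (\<lambda>A B. A \<inter> B \<noteq> {}) Ss"

definition simplex_tree :: "'v set set \<Rightarrow> bool" where
  "simplex_tree T \<longleftrightarrow>
     finite T \<and> (\<forall>S\<in>T. \<exists>k. is_simplex k S) \<and>
     (card T = 1 \<or>
       ((\<forall>A\<in>T. \<forall>B\<in>T. A \<noteq> B \<longrightarrow> card (A \<inter> B) \<le> 1) \<and>
        (\<forall>A\<in>T. \<forall>B\<in>T. \<exists>Ss. simplex_walk T Ss \<and> hd Ss = A \<and> last Ss = B) \<and>
        \<not> (\<exists>Ss. simplex_walk T Ss \<and> length Ss \<ge> 3 \<and> last Ss \<inter> hd Ss \<noteq> {})))"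

end

theory Submission
  imports Defs "HOL-Algebra.Coset" "HOL-Analysis.Convex"
begin

text \<open>
  A congruence class amounts to a function assigning a distance to every edge (a type). The only
  geometric input is that, in odd characteristic, the points equidistant from two distinct points
  form a hyperplane. Hence, for a set \<open>U\<close> of points, the number of \<open>u \<in> U\<close> at distance
  \<open>t\<close> from \<open>x\<close> deviates from its mean \<open>|U| / q\<close> by a quantity whose square, summed over
  all \<open>x\<close> and \<open>t\<close>, is at most \<open>q^d |U|\<close>.
  Delete the edges at a vertex \<open>z\<close> one at a time from the count of pairs of congruent
  \<open>n\<close>-simplices sharing \<open>z\<close>. Deleting \<open>zw\<close> costs \<open>q^d |E|\<close> times the number of
  congruent pairs of the face opposite to \<open>zw\<close>, which the main term dominates
  exactly when \<open>|E|^2 \<ge> q^(2n + d - 1)\<close>, up to constants. By Cauchy-Schwarz, a positive proportion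
  of all pairs (point of \<open>E\<close>, type) is then realised by simplices in \<open>E\<close> having that point as
  a prescribed vertex.

  For a tree, remove a leaf simplex attached at \<open>v\<close>. For a positive proportion of its types, a
  positive proportion of the points of \<open>E\<close> can play the role of \<open>v\<close>; these points again
  form a large set, in which the remaining tree has a positive proportion of its types by induction.
\<close>

section \<open>Counting coincidences\<close>

lemma sum_PiE_insert:
  fixes f :: "('i \<Rightarrow> 'p) \<Rightarrow> real"
  assumes "j \<notin> I"
  shows "(\<Sum>x\<in>insert j I \<rightarrow>\<^sub>E A. f x) = (\<Sum>u\<in>A. \<Sum>x\<in>I \<rightarrow>\<^sub>E A. f (x(j := u)))"
proof -
  have "(\<Sum>x\<in>insert j I \<rightarrow>\<^sub>E A. f x) = (\<Sum>(u, x)\<in>A \<times> (I \<rightarrow>\<^sub>E A). f (x(j := u)))"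
    unfolding PiE_insert_eq
    by (subst sum.reindex[OF inj_combinator[OF assms]]) (auto simp: case_prod_beta intro!: sum.cong)
  then show ?thesis
    by (simp add: sum.cartesian_product)
qed

text \<open>Coincidences are grouped by their common value. Only the values of \<open>f\<close> have
  to lie in \<open>R\<close>: a value that \<open>f\<close> misses takes part in no
  coincidence.\<close>

lemma sum_of_bool_eq_fibres:
  fixes f :: "'b \<Rightarrow> 't" and g :: "'c \<Rightarrow> 't"
  assumes "finite B" "finite R" "f ` B \<subseteq> R"
  shows "(\<Sum>x\<in>B. \<Sum>y\<in>C. of_bool (f x = g y)) =
    (\<Sum>t\<in>R. (\<Sum>x\<in>B. of_bool (f x = t)) * (\<Sum>y\<in>C. of_bool (g y = t)) :: real)"
proof -
  have *: "of_bool (f x = g y) = (\<Sum>t\<in>R. of_bool (f x = t) * of_bool (g y = t) :: real)"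
    if "x \<in> B" for x y
  proof -
    have "(\<Sum>t\<in>R. of_bool (f x = t) * of_bool (g y = t) :: real) =
        (\<Sum>t\<in>R. if t = f x then of_bool (g y = t) else 0)"
      by (intro sum.cong) auto
    also have "\<dots> = of_bool (f x = g y)"
      using that assms by (subst sum.delta) auto
    finally show ?thesis by simp
  qed
  have "(\<Sum>x\<in>B. \<Sum>y\<in>C. of_bool (f x = g y)) =
      (\<Sum>x\<in>B. \<Sum>y\<in>C. \<Sum>t\<in>R. of_bool (f x = t) * of_bool (g y = t) :: real)"
    using * by (intro sum.cong refl) auto
  also have "\<dots> = (\<Sum>x\<in>B. \<Sum>t\<in>R. \<Sum>y\<in>C. of_bool (f x = t) * of_bool (g y = t))"
    by (intro sum.cong refl) (rule sum.swap)
  also have "\<dots> = (\<Sum>t\<in>R. \<Sum>x\<in>B. \<Sum>y\<in>C. of_bool (f x = t) * of_bool (g y = t))"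
    by (rule sum.swap)
  finally show ?thesis
    by (simp add: sum_product)
qed

lemma sum_fibres:
  assumes "finite B" "finite R" "f ` B \<subseteq> R"
  shows "(\<Sum>t\<in>R. \<Sum>x\<in>B. of_bool (f x = t)) = real (card B)"
proof -
  have "(\<Sum>t\<in>R. \<Sum>x\<in>B. of_bool (f x = t)) = (\<Sum>x\<in>B. \<Sum>t\<in>R. of_bool (f x = t) :: real)"
    by (rule sum.swap)
  also have "\<dots> = (\<Sum>x\<in>B. \<Sum>t\<in>R. if t = f x then 1 else 0)"
    by (intro sum.cong) auto
  also have "\<dots> = (\<Sum>x\<in>B. 1)"
    using assms by (intro sum.cong refl) (subst sum.delta, auto)
  finally show ?thesis by simp
qed

lemma mult_le_half_squares: "a * b \<le> (a\<^sup>2 + b\<^sup>2) / (2 :: real)"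
  using sum_squares_bound[of a b] by simp

text \<open>The left side sums the inner products of the fibre counts of \<open>f u\<close> and
  \<open>f w\<close> over all pairs \<open>u\<close>, \<open>w\<close>. Bounding each by half the
  sum of the squared norms leaves only coincidences with \<open>u = w\<close>.\<close>

lemma coincidences_le_pinned_coincidences:
  fixes f :: "'a \<Rightarrow> 'b \<Rightarrow> 't"
  assumes "finite A" "finite B"
  shows "(\<Sum>u\<in>A. \<Sum>w\<in>A. \<Sum>x\<in>B. \<Sum>y\<in>B. of_bool (f u x = f w y)) \<le>
    real (card A) * (\<Sum>u\<in>A. \<Sum>x\<in>B. \<Sum>y\<in>B. of_bool (f u x = f u y))"
proof -
  define R where "R = (\<lambda>(u, x). f u x) ` (A \<times> B)"
  define c where "c u t = (\<Sum>x\<in>B. of_bool (f u x = t) :: real)" for u t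
  have R: "finite R" "\<And>u. u \<in> A \<Longrightarrow> f u ` B \<subseteq> R"
    using assms by (auto simp: R_def)
  have c: "(\<Sum>x\<in>B. \<Sum>y\<in>B. of_bool (f u x = f w y)) = (\<Sum>t\<in>R. c u t * c w t)"
    if "u \<in> A" for u w
    using sum_of_bool_eq_fibres[OF assms(2) R(1) R(2)[OF that], of "f w" B] by (simp add: c_def)
  have "(\<Sum>u\<in>A. \<Sum>w\<in>A. \<Sum>x\<in>B. \<Sum>y\<in>B. of_bool (f u x = f w y)) =
      (\<Sum>u\<in>A. \<Sum>w\<in>A. \<Sum>t\<in>R. c u t * c w t)"
    by (intro sum.cong refl c)
  also have "\<dots> \<le> (\<Sum>u\<in>A. \<Sum>w\<in>A. \<Sum>t\<in>R. ((c u t)\<^sup>2 + (c w t)\<^sup>2) / 2)"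
    by (intro sum_mono mult_le_half_squares)
  also have "\<dots> = real (card A) * (\<Sum>u\<in>A. \<Sum>t\<in>R. c u t * c u t)"
    by (simp add: sum.distrib add_divide_distrib power2_eq_square
        flip: sum_divide_distrib sum_distrib_left)
  also have "\<dots> = real (card A) * (\<Sum>u\<in>A. \<Sum>x\<in>B. \<Sum>y\<in>B. of_bool (f u x = f u y))"
    by (simp add: c cong: sum.cong)
  finally show ?thesis .
qed

text \<open>Cauchy-Schwarz: the fibre sizes sum to the size of \<open>A\<close>, their squares to
  the number of coincidences. Few coincidences therefore force many values.\<close>

lemma card_square_le_card_image_times_coincidences:
  assumes "finite A"
  shows "(real (card A))\<^sup>2 \<le> real (card (f ` A)) * (\<Sum>a\<in>A. \<Sum>b\<in>A. of_bool (f a = f b))"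
proof -
  define c where "c t = (\<Sum>x\<in>A. of_bool (f x = t) :: real)" for t
  have "real (card A) = (\<Sum>t\<in>f ` A. 1 * c t)"
    using sum_fibres[of A "f ` A" f] assms by (simp add: c_def)
  also have "(\<dots>)\<^sup>2 \<le> (\<Sum>t\<in>f ` A. 1\<^sup>2) * (\<Sum>t\<in>f ` A. (c t)\<^sup>2)"
    by (rule Cauchy_Schwarz_ineq_sum)
  also have "(\<Sum>t\<in>f ` A. (c t)\<^sup>2) = (\<Sum>a\<in>A. \<Sum>b\<in>A. of_bool (f a = f b))"
    using sum_of_bool_eq_fibres[of A "f ` A" f f A] assms by (simp add: c_def power2_eq_square)
  finally show ?thesis by simp
qed

section \<open>Types of embeddings, and the abstract geometry of bisectors\<close>

definition edge_type :: "('p \<Rightarrow> 'p \<Rightarrow> 'k) \<Rightarrow> 'v graph \<Rightarrow> ('v \<Rightarrow> 'p) \<Rightarrow> 'v \<times> 'v \<Rightarrow> 'k" where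
  "edge_type D G p = restrict (\<lambda>(u, v). D (p u) (p v)) (snd G)"

definition types :: "('p \<Rightarrow> 'p \<Rightarrow> 'k) \<Rightarrow> 'v graph \<Rightarrow> 'p set \<Rightarrow> ('v \<times> 'v \<Rightarrow> 'k) set" where
  "types D G E = edge_type D G ` (fst G \<rightarrow>\<^sub>E E)"

lemma edge_type_eq_iff:
  "edge_type D G p = edge_type D G p' \<longleftrightarrow> (\<forall>(u, v)\<in>snd G. D (p u) (p v) = D (p' u) (p' v))"
  by (force simp: edge_type_def restrict_def fun_eq_iff)

text \<open>The model is \<open>affine_space F d\<close> with \<open>sqdist\<close>, over a field of
  odd order. The one geometric axiom is the last: the bisector of two distinct points fills at most
  the fraction \<open>1 / card K\<close> of the space.\<close>

locale bisector_space =
  fixes V :: "'p set" and K :: "'k set" and D :: "'p \<Rightarrow> 'p \<Rightarrow> 'k"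
  assumes finite_V: "finite V" and finite_K: "finite K" and K_nonempty: "K \<noteq> {}"
    and D_closed: "x \<in> V \<Longrightarrow> y \<in> V \<Longrightarrow> D x y \<in> K"
    and D_sym: "x \<in> V \<Longrightarrow> y \<in> V \<Longrightarrow> D x y = D y x"
    and bisector: "u \<in> V \<Longrightarrow> w \<in> V \<Longrightarrow> u \<noteq> w \<Longrightarrow>
      card K * card {x \<in> V. D x u = D x w} \<le> card V"
begin

definition q :: real where "q = card K"

lemma q_ge_1: "q \<ge> 1"
  using finite_K K_nonempty by (simp add: q_def Suc_leI card_gt_0_iff)

text \<open>The deviation of the number of points of \<open>U\<close> on the sphere with centre
  \<open>x\<close> and radius \<open>t\<close> from its average over the radii in
  \<open>K\<close>.\<close>

definition excess :: "'p set \<Rightarrow> 'p \<Rightarrow> 'k \<Rightarrow> real" where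
  "excess U x t = (\<Sum>u\<in>U. of_bool (D x u = t)) - card U / q"

text \<open>Over all \<open>t\<close>, each sphere count sums to the size of its set, so the
  products with the means collapse, and the main term expected for uniformly distributed distances
  splits off exactly.\<close>

lemma sum_excess_product:
  assumes "U \<subseteq> V" "W \<subseteq> V" "x \<in> V"
  shows "(\<Sum>u\<in>U. \<Sum>w\<in>W. of_bool (D x u = D x w)) =
    real (card U) * card W / q + (\<Sum>t\<in>K. excess U x t * excess W x t)"
proof -
  have fin: "finite U" "finite W"
    using assms finite_V finite_subset by auto
  have sub: "D x ` U \<subseteq> K" "D x ` W \<subseteq> K"
    using assms D_closed by auto
  have "(\<Sum>t\<in>K. excess U x t * excess W x t) =
      (\<Sum>t\<in>K. (\<Sum>u\<in>U. of_bool (D x u = t)) * (\<Sum>w\<in>W. of_bool (D x w = t)))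
      - (\<Sum>t\<in>K. \<Sum>u\<in>U. of_bool (D x u = t)) * (card W / q)
      - (\<Sum>t\<in>K. \<Sum>w\<in>W. of_bool (D x w = t)) * (card U / q)
      + (\<Sum>t\<in>K. (card U / q) * (card W / q))"
    unfolding excess_def sum_distrib_right[of _ K] sum_subtractf[symmetric] sum.distrib[symmetric]
    by (intro sum.cong refl) (simp only: ring_distribs mult.commute[of _ "card U / q"])
  also have "\<dots> = (\<Sum>u\<in>U. \<Sum>w\<in>W. of_bool (D x u = D x w))
      - real (card U) * (card W / q) - real (card W) * (card U / q) + q * ((card U / q) * (card W / q))"
    using fin sub finite_K
    by (simp add: sum_of_bool_eq_fibres[where R = K] sum_fibres q_def del: sum_of_bool_eq)
  also have "\<dots> = (\<Sum>u\<in>U. \<Sum>w\<in>W. of_bool (D x u = D x w)) - real (card U) * card W / q"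
    using q_ge_1 by (simp add: field_simps)
  finally show ?thesis by simp
qed

text \<open>Summing the coincidences over the centre first turns a pair \<open>u \<noteq> w\<close>
  into its bisector. The bound \<open>card V / q\<close> for it is cancelled by the subtracted main
  term, so only the diagonal pairs contribute. This is where the axiom \<open>bisector\<close>
  enters.\<close>

lemma sum_excess_squares_le:
  assumes "U \<subseteq> V"
  shows "(\<Sum>x\<in>V. \<Sum>t\<in>K. (excess U x t)\<^sup>2) \<le> real (card V) * card U"
proof -
  have fin: "finite U"
    using assms finite_V finite_subset by auto
  have bis: "(\<Sum>x\<in>V. of_bool (D x u = D x w)) \<le> (if u = w then real (card V) else 0) + card V / q"
    if "u \<in> U" "w \<in> U" for u w
  proof (cases "u = w")
    case False
    have "real (card K * card {x \<in> V. D x u = D x w}) \<le> card V"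
      using bisector[of u w] that assms False by (simp only: of_nat_le_iff) blast
    then have "card {x \<in> V. D x u = D x w} \<le> card V / q"
      using q_ge_1 by (simp add: q_def field_simps)
    then show ?thesis
      using False finite_V by (simp add: of_bool_def sum.If_cases Int_def)
  qed (use q_ge_1 in simp)
  have "(\<Sum>x\<in>V. \<Sum>t\<in>K. (excess U x t)\<^sup>2) =
      (\<Sum>x\<in>V. (\<Sum>u\<in>U. \<Sum>w\<in>U. of_bool (D x u = D x w)) - real (card U) * card U / q)"
    using assms by (intro sum.cong refl) (simp add: sum_excess_product power2_eq_square)
  also have "\<dots> = (\<Sum>x\<in>V. \<Sum>u\<in>U. \<Sum>w\<in>U. of_bool (D x u = D x w)) - real (card V) * (real (card U) * card U / q)"
    by (simp add: sum_subtractf)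
  also have "(\<Sum>x\<in>V. \<Sum>u\<in>U. \<Sum>w\<in>U. of_bool (D x u = D x w)) =
      (\<Sum>u\<in>U. \<Sum>w\<in>U. \<Sum>x\<in>V. of_bool (D x u = D x w) :: real)"
    by (rule trans[OF sum.swap], rule sum.cong[OF refl], rule sum.swap)
  also have "\<dots> \<le> (\<Sum>u\<in>U. \<Sum>w\<in>U. (if u = w then real (card V) else 0) + card V / q)"
    by (intro sum_mono bis)
  also have "\<dots> = real (card U) * card V + real (card U) * real (card U) * (card V / q)"
    using fin by (simp add: sum.distrib algebra_simps)
  finally show ?thesis by (simp add: mult_ac)
qed

text \<open>The condition \<open>D x u = D x w\<close> behaves as if it held with probability
  \<open>1 / q\<close>, up to an error that does not depend on the labels: the label classes
  partition \<open>E\<close>, so their sizes add up to \<open>card E\<close> however many classes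
  there are.\<close>

lemma pinned_edge_count:
  assumes "P \<subseteq> V" "E \<subseteq> V"
  shows "(\<Sum>x\<in>P. \<Sum>u\<in>E. \<Sum>w\<in>E. of_bool (l u = l' w \<and> D x u = D x w)) \<le>
    real (card P) * (\<Sum>u\<in>E. \<Sum>w\<in>E. of_bool (l u = l' w)) / q + real (card V) * card E"
proof -
  have finE: "finite E" and finP: "finite P"
    using assms finite_V finite_subset by auto
  define R where "R = l ` E \<union> l' ` E"
  have finR: "finite R" using finE by (simp add: R_def)
  define U W where "U r = {u \<in> E. l u = r}" and "W r = {w \<in> E. l' w = r}" for r
  have sub: "U r \<subseteq> V" "W r \<subseteq> V" for r
    using assms by (auto simp: U_def W_def)
  have by_label: "(\<Sum>u\<in>E. \<Sum>w\<in>E. of_bool (l u = l' w) * h u w) = (\<Sum>r\<in>R. \<Sum>u\<in>U r. \<Sum>w\<in>W r. h u w)"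
    for h :: "'p \<Rightarrow> 'p \<Rightarrow> real"
  proof -
    have "(\<Sum>r\<in>R. \<Sum>u\<in>U r. \<Sum>w\<in>W r. h u w) =
        (\<Sum>r\<in>R. \<Sum>u\<in>{u \<in> E. l u = r}. \<Sum>w\<in>{w \<in> E. l' w = l u}. h u w)"
      unfolding U_def W_def by (intro sum.cong refl) auto
    also have "\<dots> = (\<Sum>u\<in>E. \<Sum>w\<in>{w \<in> E. l' w = l u}. h u w)"
      using finE finR by (intro sum.group) (auto simp: R_def)
    also have "\<dots> = (\<Sum>u\<in>E. \<Sum>w\<in>E. of_bool (l u = l' w) * h u w)"
      unfolding sum.inter_filter[OF finE] by (intro sum.cong refl) (simp add: of_bool_def)
    finally show ?thesis by simp
  qed
  have cardU: "(\<Sum>r\<in>R. real (card (U r))) = card E" and cardW: "(\<Sum>r\<in>R. real (card (W r))) = card E"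
    using sum.group[of E R l "\<lambda>_. 1 :: real"] sum.group[of E R l' "\<lambda>_. 1 :: real"] finE finR
    by (auto simp: U_def W_def R_def)
  have "(\<Sum>x\<in>P. \<Sum>u\<in>E. \<Sum>w\<in>E. of_bool (l u = l' w \<and> D x u = D x w)) =
      (\<Sum>x\<in>P. \<Sum>r\<in>R. \<Sum>u\<in>U r. \<Sum>w\<in>W r. of_bool (D x u = D x w) :: real)"
    by (simp only: of_bool_conj by_label)
  also have "\<dots> = (\<Sum>x\<in>P. \<Sum>r\<in>R. real (card (U r)) * card (W r) / q +
      (\<Sum>t\<in>K. excess (U r) x t * excess (W r) x t))"
    using assms sub by (intro sum.cong refl sum_excess_product) auto
  \<comment> \<open>\<open>U r\<close> and \<open>W r\<close> may be different sets, so the products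
    of their excesses are split into squares, to which the second moment bound applies.\<close>
  also have "\<dots> \<le> (\<Sum>x\<in>P. \<Sum>r\<in>R. real (card (U r)) * card (W r) / q +
      (\<Sum>t\<in>K. ((excess (U r) x t)\<^sup>2 + (excess (W r) x t)\<^sup>2) / 2))"
    by (intro sum_mono add_left_mono mult_le_half_squares)
  also have "\<dots> = (\<Sum>x\<in>P. \<Sum>r\<in>R. real (card (U r)) * card (W r) / q) +
      (\<Sum>r\<in>R. \<Sum>x\<in>P. \<Sum>t\<in>K. ((excess (U r) x t)\<^sup>2 + (excess (W r) x t)\<^sup>2) / 2)"
    by (simp add: sum.distrib sum.swap[of _ R P])
  also have "(\<Sum>x\<in>P. \<Sum>r\<in>R. real (card (U r)) * card (W r) / q) =
      real (card P) * (\<Sum>u\<in>E. \<Sum>w\<in>E. of_bool (l u = l' w)) / q"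
    using by_label[of "\<lambda>_ _. 1"] by (simp flip: sum_divide_distrib)
  also have "(\<Sum>r\<in>R. \<Sum>x\<in>P. \<Sum>t\<in>K. ((excess (U r) x t)\<^sup>2 + (excess (W r) x t)\<^sup>2) / 2) \<le>
      (\<Sum>r\<in>R. \<Sum>x\<in>V. \<Sum>t\<in>K. ((excess (U r) x t)\<^sup>2 + (excess (W r) x t)\<^sup>2) / 2)"
    using assms finite_V by (intro sum_mono sum_mono2 sum_nonneg) auto
  also have "\<dots> = (\<Sum>r\<in>R. ((\<Sum>x\<in>V. \<Sum>t\<in>K. (excess (U r) x t)\<^sup>2) +
      (\<Sum>x\<in>V. \<Sum>t\<in>K. (excess (W r) x t)\<^sup>2)) / 2)"
    by (simp add: sum.distrib add_divide_distrib flip: sum_divide_distrib)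
  also have "\<dots> \<le> (\<Sum>r\<in>R. (real (card V) * card (U r) + real (card V) * card (W r)) / 2)"
    using sub by (intro sum_mono divide_right_mono add_mono sum_excess_squares_le) auto
  also have "\<dots> = real (card V) * card E"
    by (simp add: sum.distrib add_divide_distrib cardU cardW flip: sum_divide_distrib sum_distrib_left)
  finally show ?thesis by simp
qed

end

section \<open>Pairs of congruent simplices\<close>

lemma sum_reorder:
  "(\<Sum>z\<in>A. \<Sum>u\<in>B. \<Sum>x\<in>C. \<Sum>w\<in>B. \<Sum>y\<in>C. f z u x w y) =
   (\<Sum>x\<in>C. \<Sum>y\<in>C. \<Sum>z\<in>A. \<Sum>u\<in>B. \<Sum>w\<in>B. f z u x w y)"
proof -
  have "(\<Sum>z\<in>A. \<Sum>u\<in>B. \<Sum>x\<in>C. \<Sum>w\<in>B. \<Sum>y\<in>C. f z u x w y) =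
      (\<Sum>z\<in>A. \<Sum>x\<in>C. \<Sum>u\<in>B. \<Sum>y\<in>C. \<Sum>w\<in>B. f z u x w y)"
    by (subst (2) sum.swap, subst (4) sum.swap) (rule refl)
  also have "\<dots> = (\<Sum>x\<in>C. \<Sum>y\<in>C. \<Sum>z\<in>A. \<Sum>u\<in>B. \<Sum>w\<in>B. f z u x w y)"
    by (subst (3) sum.swap, subst sum.swap, subst (2) sum.swap) (rule refl)
  finally show ?thesis .
qed

context bisector_space
begin

text \<open>The distances from an apex \<open>z\<close> to the vertices in \<open>J\<close>. The
  shape of \<open>I\<close> and the spokes to all of \<open>I\<close> together make up the type of a
  simplex with one more vertex.\<close>

definition spokes :: "'v set \<Rightarrow> 'p \<Rightarrow> ('v \<Rightarrow> 'p) \<Rightarrow> 'v \<Rightarrow> 'k" where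
  "spokes J z x = restrict (\<lambda>i. D z (x i)) J"

abbreviation shape :: "'v set \<Rightarrow> ('v \<Rightarrow> 'p) \<Rightarrow> 'v \<times> 'v \<Rightarrow> 'k" where
  "shape I \<equiv> edge_type D (complete_graph I)"

definition congruent_pairs :: "'v set \<Rightarrow> 'p set \<Rightarrow> real" where
  "congruent_pairs I E = (\<Sum>x\<in>I \<rightarrow>\<^sub>E E. \<Sum>y\<in>I \<rightarrow>\<^sub>E E. of_bool (shape I x = shape I y))"

text \<open>Two congruent configurations of \<open>I\<close> share the apex \<open>z\<close>, and
  only the spokes to \<open>J\<close> have to agree. The set \<open>J\<close> interpolates between
  congruent simplices with a common vertex (\<open>J = I\<close>) and no condition on
  \<open>z\<close> (\<open>J\<close> empty).\<close>

definition pinned_pairs :: "'v set \<Rightarrow> 'v set \<Rightarrow> 'p set \<Rightarrow> real" where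
  "pinned_pairs I J E = (\<Sum>z\<in>E. \<Sum>x\<in>I \<rightarrow>\<^sub>E E. \<Sum>y\<in>I \<rightarrow>\<^sub>E E.
     of_bool (shape I x = shape I y \<and> spokes J z x = spokes J z y))"

lemma spokes_eq_iff: "spokes J z x = spokes J w y \<longleftrightarrow> (\<forall>i\<in>J. D z (x i) = D w (y i))"
  by (auto simp: spokes_def restrict_def fun_eq_iff)

lemma shape_eq_iff:
  "shape I x = shape I y \<longleftrightarrow> (\<forall>i\<in>I. \<forall>j\<in>I. i \<noteq> j \<longrightarrow> D (x i) (x j) = D (y i) (y j))"
  by (auto simp: edge_type_eq_iff complete_graph_def)

lemma shape_insert_eq_iff:
  assumes "E \<subseteq> V" "j \<notin> I" "x \<in> I \<rightarrow>\<^sub>E E" "y \<in> I \<rightarrow>\<^sub>E E" "u \<in> E" "w \<in> E"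
  shows "shape (insert j I) (x(j := u)) = shape (insert j I) (y(j := w)) \<longleftrightarrow>
    shape I x = shape I y \<and> spokes I u x = spokes I w y"
proof -
  have "D (x i) u = D u (x i)" "D (y i) w = D w (y i)" if "i \<in> I" for i
    using that assms by (auto intro!: D_sym)
  then show ?thesis
    using assms(2) unfolding shape_eq_iff spokes_eq_iff by (auto split: if_splits)
qed

lemma spokes_upd:
  assumes "j \<notin> J"
  shows "spokes J z (x(j := u)) = spokes J z x"
  using assms by (auto simp: spokes_def)

lemma spokes_insert_upd_eq_iff:
  assumes "j \<notin> J"
  shows "spokes (insert j J) z (x(j := u)) = spokes (insert j J) z (y(j := w)) \<longleftrightarrow>
    spokes J z x = spokes J z y \<and> D z u = D z w"
  using assms by (auto simp: spokes_eq_iff)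

lemma finite_subset_V: "E \<subseteq> V \<Longrightarrow> finite E"
  using finite_V finite_subset by blast

text \<open>After splitting off \<open>j\<close>, the two copies of \<open>j\<close> sit at points
  \<open>u\<close> and \<open>w\<close>; the inequality for coincidences identifies these at the
  cost of a factor \<open>card E\<close>.\<close>

lemma congruent_pairs_insert_le:
  assumes "E \<subseteq> V" "finite I" "j \<notin> I"
  shows "congruent_pairs (insert j I) E \<le> real (card E) * pinned_pairs I I E"
proof -
  define f where "f u x = (shape I x, spokes I u x)" for u x
  have "congruent_pairs (insert j I) E =
      (\<Sum>u\<in>E. \<Sum>x\<in>I \<rightarrow>\<^sub>E E. \<Sum>w\<in>E. \<Sum>y\<in>I \<rightarrow>\<^sub>E E.
        of_bool (shape I x = shape I y \<and> spokes I u x = spokes I w y))"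
    unfolding congruent_pairs_def sum_PiE_insert[OF assms(3)]
    using assms by (intro sum.cong refl) (simp only: shape_insert_eq_iff[OF assms(1,3)])
  also have "\<dots> = (\<Sum>u\<in>E. \<Sum>w\<in>E. \<Sum>x\<in>I \<rightarrow>\<^sub>E E. \<Sum>y\<in>I \<rightarrow>\<^sub>E E. of_bool (f u x = f w y))"
    unfolding f_def prod.inject by (rule sum.cong[OF refl]) (rule sum.swap)
  also have "\<dots> \<le> real (card E) * (\<Sum>u\<in>E. \<Sum>x\<in>I \<rightarrow>\<^sub>E E. \<Sum>y\<in>I \<rightarrow>\<^sub>E E. of_bool (f u x = f u y))"
    using assms finite_subset_V
    by (intro coincidences_le_pinned_coincidences finite_PiE) auto
  finally show ?thesis
    by (simp add: f_def pinned_pairs_def del: sum_of_bool_eq)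
qed

text \<open>Deletes the spoke from \<open>z\<close> to \<open>j\<close>. For fixed \<open>x\<close>,
  \<open>y\<close> on \<open>I\<close>, the admissible apexes form \<open>P x y\<close>, and the
  points \<open>u\<close>, \<open>w\<close> at \<open>j\<close> carry as labels their distances to
  \<open>x\<close> and \<open>y\<close>. The main term trades the condition on the spoke for a
  factor \<open>1 / q\<close>; the error is \<open>card V * card E\<close> for each congruent pair
  on \<open>I\<close>, the face opposite to the spoke.\<close>

lemma pinned_pairs_insert_le:
  assumes "E \<subseteq> V" "finite I" "j \<notin> I" "J \<subseteq> I"
  shows "pinned_pairs (insert j I) (insert j J) E \<le>
    pinned_pairs (insert j I) J E / q + real (card V) * real (card E) * congruent_pairs I E"
proof -
  have jJ: "j \<notin> J"
    using assms by auto
  have finE: "finite E"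
    using assms finite_subset_V by auto
  \<comment> \<open>Since \<open>j\<close> is not in \<open>J\<close>, the remaining condition on
    \<open>z\<close> does not involve \<open>u\<close> and \<open>w\<close>.\<close>
  define P where "P x y = {z \<in> E. spokes J z x = spokes J z y}" for x y
  have P: "(\<Sum>z\<in>E. of_bool (spokes J z x = spokes J z y) * h z) = (\<Sum>z\<in>P x y. h z)"
    for x y and h :: "'p \<Rightarrow> real"
    unfolding P_def sum.inter_filter[OF finE] by (intro sum.cong refl) (simp add: of_bool_def)
  define C where "C x y = (\<Sum>u\<in>E. \<Sum>w\<in>E. of_bool (spokes I u x = spokes I w y) :: real)" for x y
  have peel: "(\<Sum>z\<in>P x y. \<Sum>u\<in>E. \<Sum>w\<in>E. of_bool (spokes I u x = spokes I w y \<and> D z u = D z w)) \<le>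
      real (card (P x y)) * C x y / q + real (card V) * card E" for x y
    unfolding C_def by (rule pinned_edge_count) (use assms in \<open>auto simp: P_def\<close>)
  have "pinned_pairs (insert j I) (insert j J) E =
      (\<Sum>z\<in>E. \<Sum>u\<in>E. \<Sum>x\<in>I \<rightarrow>\<^sub>E E. \<Sum>w\<in>E. \<Sum>y\<in>I \<rightarrow>\<^sub>E E.
        of_bool (shape I x = shape I y) * (of_bool (spokes J z x = spokes J z y) *
          of_bool (spokes I u x = spokes I w y \<and> D z u = D z w)))"
    unfolding pinned_pairs_def sum_PiE_insert[OF assms(3)]
    using assms jJ
    by (intro sum.cong refl) (simp add: shape_insert_eq_iff[OF assms(1,3)] spokes_insert_upd_eq_iff)
  also have "\<dots> = (\<Sum>x\<in>I \<rightarrow>\<^sub>E E. \<Sum>y\<in>I \<rightarrow>\<^sub>E E. of_bool (shape I x = shape I y) *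
      (\<Sum>z\<in>P x y. \<Sum>u\<in>E. \<Sum>w\<in>E. of_bool (spokes I u x = spokes I w y \<and> D z u = D z w)))"
    by (subst sum_reorder) (simp only: P flip: sum_distrib_left)
  also have "\<dots> \<le> (\<Sum>x\<in>I \<rightarrow>\<^sub>E E. \<Sum>y\<in>I \<rightarrow>\<^sub>E E. of_bool (shape I x = shape I y) *
      (real (card (P x y)) * C x y / q + real (card V) * card E))"
    by (intro sum_mono mult_left_mono peel) simp
  also have "\<dots> = (\<Sum>x\<in>I \<rightarrow>\<^sub>E E. \<Sum>y\<in>I \<rightarrow>\<^sub>E E. of_bool (shape I x = shape I y) *
      (real (card (P x y)) * C x y)) / q + real (card V) * real (card E) * congruent_pairs I E"
    by (simp only: congruent_pairs_def distrib_left sum.distrib sum_divide_distrib sum_distrib_left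
        times_divide_eq_right mult.commute[of _ "real (card V) * card E"])
  also have "(\<Sum>x\<in>I \<rightarrow>\<^sub>E E. \<Sum>y\<in>I \<rightarrow>\<^sub>E E. of_bool (shape I x = shape I y) * (real (card (P x y)) * C x y)) =
      (\<Sum>x\<in>I \<rightarrow>\<^sub>E E. \<Sum>y\<in>I \<rightarrow>\<^sub>E E. of_bool (shape I x = shape I y) *
      (\<Sum>z\<in>P x y. \<Sum>u\<in>E. \<Sum>w\<in>E. of_bool (spokes I u x = spokes I w y)))"
    by (simp add: C_def del: sum_of_bool_eq)
  also have "\<dots> = (\<Sum>z\<in>E. \<Sum>u\<in>E. \<Sum>x\<in>I \<rightarrow>\<^sub>E E. \<Sum>w\<in>E. \<Sum>y\<in>I \<rightarrow>\<^sub>E E.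
        of_bool (shape I x = shape I y) * (of_bool (spokes J z x = spokes J z y) *
          of_bool (spokes I u x = spokes I w y)))"
    by (subst sum_reorder) (simp only: P flip: sum_distrib_left)
  also have "\<dots> = pinned_pairs (insert j I) J E"
    unfolding pinned_pairs_def sum_PiE_insert[OF assms(3)]
    using assms jJ
    by (intro sum.cong refl) (auto simp: shape_insert_eq_iff[OF assms(1,3)] spokes_upd)
  finally show ?thesis .
qed

lemma pinned_pairs_empty: "pinned_pairs I {} E = real (card E) * congruent_pairs I E"
  by (simp add: pinned_pairs_def congruent_pairs_def spokes_eq_iff del: sum_of_bool_eq)

text \<open>The spokes are deleted one at a time with \<open>I\<close> fixed. Each deletion gains a
  factor \<open>1 / q\<close> in the main term and costs one more error; in the end \<open>z\<close>
  is free.\<close>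

lemma pinned_pairs_le:
  assumes "E \<subseteq> V" "finite I" and B: "\<And>j. j \<in> I \<Longrightarrow> congruent_pairs (I - {j}) E \<le> B"
  shows "pinned_pairs I I E \<le>
    real (card E) * congruent_pairs I E / q ^ card I + real (card I) * (real (card V) * real (card E) * B)"
proof -
  have "pinned_pairs I J E \<le>
      real (card E) * congruent_pairs I E / q ^ card J + real (card J) * (real (card V) * real (card E) * B)"
    if "J \<subseteq> I" for J
    using finite_subset[OF that assms(2)] that
  proof (induction J rule: finite_induct)
    case empty
    then show ?case by (simp add: pinned_pairs_empty)
  next
    case (insert j J)
    define X where "X = real (card V) * real (card E) * B"
    have "0 \<le> congruent_pairs (I - {j}) E"
      unfolding congruent_pairs_def by (intro sum_nonneg) auto
    then have X: "0 \<le> X"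
      using B[of j] insert.prems by (auto simp: X_def intro!: mult_nonneg_nonneg)
    have "pinned_pairs I (insert j J) E \<le>
        pinned_pairs I J E / q + real (card V) * real (card E) * congruent_pairs (I - {j}) E"
      using pinned_pairs_insert_le[of E "I - {j}" j J] insert assms(1,2)
      by (auto simp: insert_absorb)
    also have "\<dots> \<le> pinned_pairs I J E / q + X"
      unfolding X_def using insert.prems by (intro add_left_mono mult_left_mono B) auto
    also have "\<dots> \<le> (real (card E) * congruent_pairs I E / q ^ card J + real (card J) * X) / q + X"
      using insert q_ge_1 by (intro add_right_mono divide_right_mono) (auto simp: X_def)
    also have "\<dots> = real (card E) * congruent_pairs I E / q ^ card (insert j J) + real (card J) * X / q + X"
      using insert by (simp add: add_divide_distrib mult.commute)
    \<comment> \<open>The errors from the spokes in \<open>J\<close> even shrink by the factor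
      \<open>1 / q\<close>; this gain is given away.\<close>
    also have "real (card J) * X / q \<le> real (card J) * X"
      using divide_left_mono[of 1 q "real (card J) * X"] q_ge_1 X by simp
    finally show ?case
      using insert by (simp add: X_def algebra_simps)
  qed
  from this[of I] show ?thesis by simp
qed

text \<open>For |V| = q^d the size condition reads |E|^2 \<ge> q^(2n + d - 1). It keeps the errors
  from deleting spokes no larger than the bound for the main term.\<close>

lemma pinned_pairs_bound_step:
  assumes E: "E \<subseteq> V" "real (card V) * q ^ (2 * n) \<le> (real (card E))\<^sup>2 * q"
    and I: "finite I" "card I \<le> n"
    and IH: "\<And>I'. I' \<subseteq> I \<Longrightarrow> q ^ (card I' choose 2) * congruent_pairs I' E \<le>
      fact (card I') * real (card E) ^ (2 * card I')"
  shows "q ^ (Suc (card I) choose 2) * pinned_pairs I I E \<le>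
    fact (Suc (card I)) * real (card E) ^ (2 * card I + 1)"
proof (cases "card I")
  case 0
  then show ?thesis
    using I by (simp add: pinned_pairs_empty congruent_pairs_def edge_type_eq_iff numeral_2_eq_2)
next
  case (Suc k)
  define e where "e = real (card E)"
  define r where "r = q ^ (k choose 2)"
  have q0: "q > 0" and r0: "r > 0"
    using q_ge_1 by (auto simp: r_def)
  define B where "B = fact k * e ^ (2 * k) / r"
  have B: "congruent_pairs (I - {j}) E \<le> B" if "j \<in> I" for j
    using IH[of "I - {j}"] that Suc I q0 by (auto simp: B_def e_def r_def field_simps)
  have NI: "q ^ (Suc k choose 2) * congruent_pairs I E \<le> fact (Suc k) * e ^ (2 * Suc k)"
    using IH[of I] unfolding Suc e_def by simp
  \<comment> \<open>For \<open>Suc k \<le> n\<close> vertices the exponent \<open>2 * Suc k\<close>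
    suffices. Cancelling one \<open>q\<close> leaves \<open>2 * k + 1\<close>, the number
    \<open>k + Suc k\<close> of powers of \<open>q\<close> that remain on the error once
    \<open>r\<close> has cancelled against \<open>B\<close>.\<close>
  have "real (card V) * q ^ (2 * Suc k) \<le> real (card V) * q ^ (2 * n)"
    using I Suc q_ge_1 by (intro mult_left_mono power_increasing) auto
  also have "\<dots> \<le> e\<^sup>2 * q"
    using E by (simp add: e_def)
  finally have V: "real (card V) * q ^ (2 * k + 1) \<le> e\<^sup>2"
    using q0 by (simp add: mult_ac)
  have exps: "q ^ (Suc k choose 2) = r * q ^ k" "q ^ (Suc (Suc k) choose 2) = r * q ^ k * q ^ Suc k"
    by (simp_all add: r_def numeral_2_eq_2 power_add mult_ac)
  have q_square: "q ^ (2 * k + 1) = q ^ k * q ^ k * q"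
    by (simp add: mult_2 power_add)
  have "r * q ^ k * q ^ Suc k * pinned_pairs I I E \<le>
      r * q ^ k * q ^ Suc k * (e * congruent_pairs I E / q ^ Suc k + Suc k * (real (card V) * e * B))"
    using pinned_pairs_le[OF E(1) I(1) B] q0 r0 unfolding Suc e_def
    by (intro mult_left_mono) auto
  also have "\<dots> = e * (r * q ^ k * congruent_pairs I E) +
      fact (Suc k) * e ^ (2 * k + 1) * (real (card V) * q ^ (2 * k + 1))"
    using q0 r0 unfolding B_def q_square by (simp add: field_simps)
  also have "\<dots> \<le> e * (fact (Suc k) * e ^ (2 * Suc k)) + fact (Suc k) * e ^ (2 * k + 1) * e\<^sup>2"
    using NI V unfolding exps by (intro add_mono mult_left_mono) (auto simp: e_def)
  also have "\<dots> = fact (Suc k) * (e * e ^ (2 * Suc k)) + fact (Suc k) * (e ^ (2 * k + 1) * e\<^sup>2)"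
    by (simp only: mult_ac)
  also have "e * e ^ (2 * Suc k) = e ^ (2 * Suc k + 1)"
    by simp
  also have "e ^ (2 * k + 1) * e\<^sup>2 = e ^ (2 * Suc k + 1)"
    by (simp add: power2_eq_square)
  also have "fact (Suc k) * e ^ (2 * Suc k + 1) + fact (Suc k) * e ^ (2 * Suc k + 1) =
      2 * (fact (Suc k) * e ^ (2 * Suc k + 1))"
    by (rule mult_2[symmetric])
  \<comment> \<open>The main term and the error contribute one \<open>fact (Suc k)\<close> each; the
    next factor of the factorial absorbs this doubling.\<close>
  also have "\<dots> \<le> real (Suc (Suc k)) * (fact (Suc k) * e ^ (2 * Suc k + 1))"
    by (intro mult_right_mono) (auto simp: e_def)
  also have "\<dots> = fact (Suc (Suc k)) * e ^ (2 * Suc k + 1)"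
    by (simp only: fact_Suc of_nat_mult mult.assoc)
  finally show ?thesis
    unfolding Suc exps e_def by simp
qed

text \<open>Up to the factorial, this is the number of congruent pairs to be expected if all q^(k
  choose 2) types, for \<open>k = card I\<close>, were equally frequent. Removing a vertex leads to
  pinned pairs, which need the bound for several smaller sizes; hence the strong induction. The
  limit \<open>Suc n\<close> is the number of vertices of an \<open>n\<close>-simplex.\<close>

lemma congruent_pairs_bound:
  assumes E: "E \<subseteq> V" "real (card V) * q ^ (2 * n) \<le> (real (card E))\<^sup>2 * q"
  shows "finite I \<Longrightarrow> card I \<le> Suc n \<Longrightarrow>
    q ^ (card I choose 2) * congruent_pairs I E \<le> fact (card I) * real (card E) ^ (2 * card I)"
proof (induction "card I" arbitrary: I rule: less_induct)
  case less
  show ?case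
  proof (cases "I = {}")
    case True
    then show ?thesis
      by (simp add: congruent_pairs_def edge_type_eq_iff numeral_2_eq_2)
  next
    case False
    then obtain j I' where I: "I = insert j I'" "j \<notin> I'"
      by (meson mk_disjoint_insert ex_in_conv)
    have fin: "finite I'" and card: "card I = Suc (card I')"
      using I less.prems by auto
    have IH: "q ^ (card J choose 2) * congruent_pairs J E \<le> fact (card J) * real (card E) ^ (2 * card J)"
      if "J \<subseteq> I'" for J
    proof (rule less.hyps)
      show "card J < card I" "card J \<le> Suc n"
        using card_mono[OF fin that] card less.prems by auto
    qed (use that fin finite_subset in blast)
    have "q ^ (card I choose 2) * congruent_pairs I E \<le>
        q ^ (card I choose 2) * (real (card E) * pinned_pairs I' I' E)"
      unfolding I(1) using q_ge_1 congruent_pairs_insert_le[OF E(1) fin I(2)]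
      by (intro mult_left_mono) auto
    also have "\<dots> = real (card E) * (q ^ (Suc (card I') choose 2) * pinned_pairs I' I' E)"
      by (simp add: card mult_ac)
    also have "\<dots> \<le> real (card E) * (fact (Suc (card I')) * real (card E) ^ (2 * card I' + 1))"
      using card less.prems by (intro mult_left_mono pinned_pairs_bound_step[OF E fin _ IH]) auto
    also have "\<dots> = fact (card I) * real (card E) ^ (2 * card I)"
      by (simp add: card mult_ac)
    finally show ?thesis .
  qed
qed

text \<open>Cauchy-Schwarz for the map to (point at \<open>v\<close>, type): a coincidence is a pair
  of congruent simplices sharing the point at \<open>v\<close>, and these are few. Recording the
  point at \<open>v\<close> is what later allows gluing there.\<close>

lemma pinned_types_bound:
  assumes E: "E \<subseteq> V" "real (card V) * q ^ (2 * n) \<le> (real (card E))\<^sup>2 * q"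
    and S: "finite S" "v \<in> S" "card S \<le> Suc n"
  shows "real (card E) * q ^ (card S choose 2) \<le>
    fact (card S) * real (card ((\<lambda>p. (p v, shape S p)) ` (S \<rightarrow>\<^sub>E E)))"
proof (cases "E = {}")
  case False
  define I where "I = S - {v}"
  have "card S = Suc (card I)"
    using card.remove[OF S(1,2)] by (simp only: I_def)
  moreover have "S = insert v I" "v \<notin> I" "finite I"
    using S by (auto simp: I_def)
  ultimately have I: "S = insert v I" "v \<notin> I" "finite I" "card S = Suc (card I)"
    by blast+
  define F where "F = (\<lambda>p. (p v, shape S p))"
  define e where "e = real (card E)"
  have e0: "e > 0"
    using False finite_subset_V[OF E(1)] by (simp add: e_def card_gt_0_iff)
  have fin: "finite (S \<rightarrow>\<^sub>E E)"
    using S E finite_subset_V by (intro finite_PiE) auto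
  have bound: "q ^ (card S choose 2) * pinned_pairs I I E \<le> fact (card S) * e ^ (2 * card I + 1)"
    unfolding I(4) e_def using S I
    by (intro pinned_pairs_bound_step[OF E I(3)] congruent_pairs_bound[OF E])
      (auto intro: finite_subset order.trans[OF card_mono[OF I(3)]])
  have "(\<Sum>a\<in>S \<rightarrow>\<^sub>E E. \<Sum>b\<in>S \<rightarrow>\<^sub>E E. of_bool (F a = F b) :: real) =
      (\<Sum>u\<in>E. \<Sum>x\<in>I \<rightarrow>\<^sub>E E. \<Sum>w\<in>E. \<Sum>y\<in>I \<rightarrow>\<^sub>E E.
        of_bool (u = w) * of_bool (shape I x = shape I y \<and> spokes I u x = spokes I w y))"
    unfolding I(1) sum_PiE_insert[OF I(2)] F_def using E I(2)
    by (intro sum.cong refl) (auto simp: shape_insert_eq_iff[OF E(1) I(2)])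
  \<comment> \<open>The factor \<open>of_bool (u = w)\<close> comes from recording the point at
    \<open>v\<close>; it merges \<open>u\<close> and \<open>w\<close> into one apex.\<close>
  also have "\<dots> = (\<Sum>u\<in>E. \<Sum>x\<in>I \<rightarrow>\<^sub>E E. \<Sum>w\<in>E. if w = u then
        (\<Sum>y\<in>I \<rightarrow>\<^sub>E E. of_bool (shape I x = shape I y \<and> spokes I u x = spokes I w y)) else 0)"
    by (intro sum.cong refl) (simp del: sum_of_bool_eq)
  also have "\<dots> = pinned_pairs I I E"
    unfolding pinned_pairs_def using finite_subset_V[OF E(1)]
    by (intro sum.cong refl) (subst sum.delta, auto)
  finally have M: "(\<Sum>a\<in>S \<rightarrow>\<^sub>E E. \<Sum>b\<in>S \<rightarrow>\<^sub>E E. of_bool (F a = F b) :: real) = pinned_pairs I I E" .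
  have square: "(e ^ card S)\<^sup>2 = e * e ^ (2 * card I + 1)"
    by (simp add: I(4) power2_eq_square mult_2 power_add)
  have "(e ^ card S)\<^sup>2 \<le> real (card (F ` (S \<rightarrow>\<^sub>E E))) * pinned_pairs I I E"
    using card_square_le_card_image_times_coincidences[OF fin, of F] S
    unfolding M by (simp add: card_funcsetE e_def)
  then have "q ^ (card S choose 2) * (e ^ card S)\<^sup>2 \<le>
      q ^ (card S choose 2) * (real (card (F ` (S \<rightarrow>\<^sub>E E))) * pinned_pairs I I E)"
    using q_ge_1 by (intro mult_left_mono) auto
  also have "\<dots> = real (card (F ` (S \<rightarrow>\<^sub>E E))) * (q ^ (card S choose 2) * pinned_pairs I I E)"
    by simp
  also have "\<dots> \<le> real (card (F ` (S \<rightarrow>\<^sub>E E))) * (fact (card S) * e ^ (2 * card I + 1))"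
    using bound by (intro mult_left_mono) auto
  finally have "e * q ^ (card S choose 2) * e ^ (2 * card I + 1) \<le>
      fact (card S) * real (card (F ` (S \<rightarrow>\<^sub>E E))) * e ^ (2 * card I + 1)"
    unfolding square by (simp only: mult_ac)
  then show ?thesis
    using e0 unfolding F_def e_def by (simp add: mult.commute)
qed simp

end

section \<open>Simplex trees\<close>

text \<open>On \<open>A\<close>, the map \<open>f\<close> factors through \<open>g\<close>.\<close>

lemma card_image_le_card_image:
  assumes "finite A" "\<And>a b. a \<in> A \<Longrightarrow> b \<in> A \<Longrightarrow> g a = g b \<Longrightarrow> f a = f b"
  shows "card (f ` A) \<le> card (g ` A)"
proof -
  have "f (inv_into A g (g a)) = f a" if "a \<in> A" for a
    using that by (intro assms(2)) (auto intro: inv_into_into f_inv_into_f)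
  then have "f ` A = (f \<circ> inv_into A g) ` g ` A"
    by force
  then show ?thesis
    using assms(1) by (metis card_image_le finite_imageI)
qed

section \<open>Unions of graphs and their types\<close>

definition graph_union :: "'v graph \<Rightarrow> 'v graph \<Rightarrow> 'v graph" where
  "graph_union G H = (fst G \<union> fst H, snd G \<union> snd H)"

lemma union_graph_insert:
  "union_graph (insert S T) = graph_union (union_graph T) (complete_graph S)"
  by (auto simp: union_graph_def graph_union_def)

lemma union_graph_singleton: "union_graph {S} = complete_graph S"
  by (simp add: union_graph_def)

lemma fst_union_graph: "fst (union_graph T) = \<Union>T"
  by (simp add: union_graph_def complete_graph_def)

lemma fst_complete_graph [simp]: "fst (complete_graph S) = S"
  by (simp add: complete_graph_def)

lemma edges_complete_graph: "snd (complete_graph S) \<subseteq> S \<times> S"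
  by (auto simp: complete_graph_def)

lemma edges_union_graph: "snd (union_graph T) \<subseteq> fst (union_graph T) \<times> fst (union_graph T)"
  by (auto simp: union_graph_def complete_graph_def)

lemma edge_type_in_types:
  assumes "p \<in> A \<rightarrow>\<^sub>E E" "fst G \<subseteq> A" "snd G \<subseteq> fst G \<times> fst G"
  shows "edge_type D G p \<in> types D G E"
proof -
  have "edge_type D G p = edge_type D G (restrict p (fst G))"
    using assms(3) by (auto simp: edge_type_eq_iff)
  moreover have "restrict p (fst G) \<in> fst G \<rightarrow>\<^sub>E E"
    using assms(1,2) by auto
  ultimately show ?thesis
    unfolding types_def by blast
qed

lemma finite_types: "finite (fst G) \<Longrightarrow> finite E \<Longrightarrow> finite (types D G E)"
  unfolding types_def by (intro finite_imageI finite_PiE) auto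

text \<open>The type of the union is determined by the types of the two parts. This bounds the total
  number of types of a tree, against which the proportion is measured.\<close>

lemma card_types_graph_union_le:
  assumes "finite (fst G)" "finite (fst H)" "finite E"
    "snd G \<subseteq> fst G \<times> fst G" "snd H \<subseteq> fst H \<times> fst H"
  shows "card (types D (graph_union G H) E) \<le> card (types D G E) * card (types D H E)"
proof -
  let ?A = "fst (graph_union G H) \<rightarrow>\<^sub>E E" and ?g = "\<lambda>p. (edge_type D G p, edge_type D H p)"
  have "card (types D (graph_union G H) E) \<le> card (?g ` ?A)"
    unfolding types_def using assms
    by (intro card_image_le_card_image finite_PiE) (auto simp: graph_union_def edge_type_eq_iff)
  also have "?g ` ?A \<subseteq> types D G E \<times> types D H E"
    using assms by (auto simp: graph_union_def intro!: edge_type_in_types[where A = "fst G \<union> fst H"])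
  then have "card (?g ` ?A) \<le> card (types D G E \<times> types D H E)"
    using assms by (intro card_mono finite_cartesian_product finite_types)
  finally show ?thesis
    by (simp add: card_cartesian_product)
qed

section \<open>Types of a simplex, and attaching a simplex at a vertex\<close>

context bisector_space
begin

text \<open>A new vertex \<open>j\<close> adds \<open>card I\<close> distances, each with at most
  \<open>q\<close> values.\<close>

lemma card_types_complete_graph_le:
  assumes "finite S"
  shows "real (card (types D (complete_graph S) V)) \<le> q ^ (card S choose 2)"
  using assms
proof (induction S rule: finite_induct)
  case empty
  then show ?case by (simp add: types_def numeral_2_eq_2)
next
  case (insert j I)
  let ?A = "insert j I \<rightarrow>\<^sub>E V" and ?g = "\<lambda>p. (shape I p, spokes I (p j) p)"
  have "card (types D (complete_graph (insert j I)) V) \<le> card (?g ` ?A)"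
    unfolding types_def fst_complete_graph
  proof (intro card_image_le_card_image)
    fix x y assume xy: "x \<in> ?A" "y \<in> ?A" and eq: "?g x = ?g y"
    have "D (x i) (x j) = D (x j) (x i)" "D (y i) (y j) = D (y j) (y i)" if "i \<in> I" for i
      using xy that by (auto intro!: D_sym)
    then show "shape (insert j I) x = shape (insert j I) y"
      using eq unfolding prod.inject shape_eq_iff spokes_eq_iff by auto
  qed (use insert finite_V in \<open>auto intro!: finite_PiE\<close>)
  also have "?g ` ?A \<subseteq> types D (complete_graph I) V \<times> (I \<rightarrow>\<^sub>E K)"
  proof -
    have "shape I p \<in> types D (complete_graph I) V" "spokes I (p j) p \<in> I \<rightarrow>\<^sub>E K" if "p \<in> ?A" for p
      using that edges_complete_graph[of I] edge_type_in_types[OF that, of "complete_graph I" D]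
      by (auto simp: spokes_def intro!: D_closed)
    then show ?thesis by auto
  qed
  then have "card (?g ` ?A) \<le> card (types D (complete_graph I) V \<times> (I \<rightarrow>\<^sub>E K))"
    using insert finite_V finite_K
    by (intro card_mono finite_cartesian_product finite_types finite_PiE) auto
  also have "\<dots> = card (types D (complete_graph I) V) * card K ^ card I"
    using insert by (simp add: card_cartesian_product card_funcsetE)
  finally have "real (card (types D (complete_graph (insert j I)) V)) \<le>
      real (card (types D (complete_graph I) V) * card K ^ card I)"
    by (simp only: of_nat_le_iff)
  also have "\<dots> = real (card (types D (complete_graph I) V)) * q ^ card I"
    by (simp add: q_def)
  also have "\<dots> \<le> q ^ (card I choose 2) * q ^ card I"
    using insert q_ge_1 by (intro mult_right_mono) auto
  also have "\<dots> = q ^ (card (insert j I) choose 2)"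
    using insert by (simp add: numeral_2_eq_2 power_add)
  finally show ?case .
qed

text \<open>Each type occurs with at most \<open>card E\<close> positions of a chosen vertex
  \<open>v\<close>, so forgetting the point at \<open>v\<close> divides the count in
  \<open>pinned_types_bound\<close> by at most \<open>card E\<close>.\<close>

lemma card_types_simplex_ge:
  assumes E: "E \<subseteq> V" "E \<noteq> {}" "real (card V) * q ^ (2 * n) \<le> (real (card E))\<^sup>2 * q"
    and S: "finite S" "S \<noteq> {}" "card S \<le> Suc n"
  shows "q ^ (card S choose 2) \<le> fact (card S) * real (card (types D (complete_graph S) E))"
proof -
  obtain v where v: "v \<in> S"
    using S by auto
  have fin: "finite E"
    using E finite_subset_V by auto
  have "(\<lambda>p. (p v, shape S p)) ` (S \<rightarrow>\<^sub>E E) \<subseteq> E \<times> types D (complete_graph S) E"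
    using v by (auto simp: types_def)
  then have "card ((\<lambda>p. (p v, shape S p)) ` (S \<rightarrow>\<^sub>E E)) \<le> card (E \<times> types D (complete_graph S) E)"
    using fin S by (intro card_mono finite_cartesian_product finite_types) auto
  then have *: "real (card ((\<lambda>p. (p v, shape S p)) ` (S \<rightarrow>\<^sub>E E))) \<le>
      real (card E) * card (types D (complete_graph S) E)"
    by (simp add: card_cartesian_product flip: of_nat_mult)
  have "real (card E) * q ^ (card S choose 2) \<le>
      fact (card S) * real (card ((\<lambda>p. (p v, shape S p)) ` (S \<rightarrow>\<^sub>E E)))"
    by (rule pinned_types_bound[OF E(1,3) S(1) v S(3)])
  also have "\<dots> \<le> fact (card S) * (real (card E) * card (types D (complete_graph S) E))"
    using * by (intro mult_left_mono) auto
  also have "\<dots> = real (card E) * (fact (card S) * real (card (types D (complete_graph S) E)))"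
    by simp
  finally show ?thesis
    using E fin by (simp add: card_gt_0_iff)
qed

text \<open>A type of \<open>S\<close> is good if at least the fraction
  \<open>1 / (2 * fact (card S))\<close> of the points of \<open>E\<close> can serve as
  \<open>v\<close> for it. For each good type, at least \<open>b\<close> types of \<open>G\<close>
  are realised within these points, and each can be completed by a simplex of the good type.\<close>

lemma card_types_attach_simplex_ge:
  assumes E: "E \<subseteq> V" "E \<noteq> {}" "real (card V) * q ^ (2 * n) \<le> (real (card E))\<^sup>2 * q"
    and S: "finite S" "card S \<le> Suc n" and G: "finite (fst G)" "snd G \<subseteq> fst G \<times> fst G"
    and v: "S \<inter> fst G = {v}"
    and IH: "\<And>E'. E' \<subseteq> E \<Longrightarrow> real (card E) \<le> 2 * fact (card S) * real (card E') \<Longrightarrow>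
      b \<le> real (card (types D G E'))"
    and b: "0 \<le> b"
  shows "q ^ (card S choose 2) * b \<le>
    2 * fact (card S) * real (card (types D (graph_union G (complete_graph S)) E))"
proof -
  define Q where "Q = q ^ (card S choose 2)"
  define f :: real where "f = fact (card S)"
  define T where "T = types D (complete_graph S) E"
  define X where "X = (\<lambda>p. (p v, shape S p)) ` (S \<rightarrow>\<^sub>E E)"
  define Et where "Et t = {x \<in> E. (x, t) \<in> X}" for t
  define good where "good = {t \<in> T. real (card E) \<le> 2 * f * real (card (Et t))}"
  have vS: "v \<in> S"
    using v by auto
  have finE: "finite E"
    using E finite_subset_V by auto
  have finT: "finite T"
    unfolding T_def using S finE by (intro finite_types) auto
  have f0: "f > 0" and Q0: "Q > 0" and e0: "real (card E) > 0"
    using q_ge_1 E finE by (auto simp: f_def Q_def card_gt_0_iff)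
  have "real (card T) \<le> card (types D (complete_graph S) V)"
    unfolding T_def of_nat_le_iff using S E finite_V
    by (intro card_mono finite_types) (auto simp: types_def intro!: image_mono PiE_mono)
  also have "\<dots> \<le> Q"
    unfolding Q_def by (rule card_types_complete_graph_le[OF S(1)])
  finally have cardT: "real (card T) \<le> Q" .
  have "X = (\<lambda>(t, x). (x, t)) ` (SIGMA t:T. Et t)"
    using vS by (force simp: X_def Et_def T_def types_def image_iff)
  then have "card X = card (SIGMA t:T. Et t)"
    by (simp add: card_image inj_on_def)
  also have "\<dots> = (\<Sum>t\<in>T. card (Et t))"
    using finT finE by (intro card_SigmaI) (auto simp: Et_def)
  finally have cardX: "real (card X) = (\<Sum>t\<in>T. real (card (Et t)))"
    by simp
  have "real (card E) * Q \<le> f * real (card X)"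
    using pinned_types_bound[OF E(1,3) S(1) vS S(2)] by (simp add: f_def Q_def X_def)
  \<comment> \<open>A type that is not good has fewer than \<open>card E / (2 * f)\<close> points.
    As there are at most \<open>Q\<close> types, these account for at most half of the left side,
    which explains the 2 in \<open>good\<close>.\<close>
  also have "\<dots> \<le> f * (\<Sum>t\<in>T. (if t \<in> good then real (card E) else 0) + real (card E) / (2 * f))"
    unfolding cardX
  proof (intro mult_left_mono sum_mono)
    fix t assume t: "t \<in> T"
    have le: "card (Et t) \<le> card E"
      using finE by (intro card_mono) (auto simp: Et_def)
    have nonneg: "0 \<le> real (card E) / (2 * f)"
      using f0 by simp
    show "real (card (Et t)) \<le> (if t \<in> good then real (card E) else 0) + real (card E) / (2 * f)"
    proof (cases "t \<in> good")
      case True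
      then show ?thesis using le nonneg by simp
    next
      case False
      then show ?thesis using t f0 by (simp add: good_def field_simps)
    qed
  qed (use f0 in auto)
  also have "\<dots> = f * (real (card good) * real (card E) + real (card T) * (real (card E) / (2 * f)))"
    using finT by (simp add: sum.distrib sum.If_cases good_def Int_def)
  also have "\<dots> = f * real (card good) * real (card E) + real (card T) * real (card E) / 2"
    using f0 by (simp add: field_simps)
  also have "\<dots> \<le> f * real (card good) * real (card E) + Q * real (card E) / 2"
    using cardT by (intro add_left_mono divide_right_mono mult_right_mono) auto
  finally have "real (card E) * Q \<le> real (card E) * (2 * f * real (card good))"
    by (simp add: algebra_simps)
  then have good: "Q \<le> 2 * f * real (card good)"
    using e0 by simp
  define U where "U = graph_union G (complete_graph S)"
  define B where "B = (SIGMA t:good. types D G (Et t))"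
  have finU: "finite (types D U E)"
    using G S finE unfolding U_def by (intro finite_types) (auto simp: graph_union_def)
  \<comment> \<open>Restricting a type of the union to the edges of either part recovers the pair,
    so different pairs come from different types of the union.\<close>
  have "B \<subseteq> (\<lambda>t. (restrict t (snd (complete_graph S)), restrict t (snd G))) ` types D U E"
  proof (clarsimp simp: B_def)
    fix t t' assume t: "t \<in> good" "t' \<in> types D G (Et t)"
    then obtain p' where p': "p' \<in> fst G \<rightarrow>\<^sub>E Et t" "t' = edge_type D G p'"
      by (auto simp: types_def)
    then have "p' v \<in> Et t"
      using v by auto
    then obtain p where p: "p \<in> S \<rightarrow>\<^sub>E E" "p v = p' v" "t = shape S p"
      by (auto simp: Et_def X_def)
    \<comment> \<open>All of \<open>G\<close> is placed in \<open>Et t\<close>, in particular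
      \<open>v\<close>. Hence some simplex of type \<open>t\<close> in \<open>E\<close> has the same
      point at \<open>v\<close>, the only common vertex, and the two embeddings glue.\<close>
    define r where "r x = (if x \<in> S then p x else p' x)" for x
    have r: "r x = p' x" if "x \<in> fst G" for x
      using that v p(2) by (auto simp: r_def)
    have "r \<in> fst U \<rightarrow>\<^sub>E E"
      using p(1) p'(1) by (auto simp: r_def U_def graph_union_def PiE_iff extensional_def Et_def)
    moreover have "restrict (edge_type D U r) (snd (complete_graph S)) = t"
      unfolding p(3) edge_type_def
      by (auto simp: r_def U_def graph_union_def complete_graph_def restrict_def fun_eq_iff)
    moreover have "restrict (edge_type D U r) (snd G) = t'"
      unfolding p'(2) edge_type_def using G(2) r
      by (auto simp: U_def graph_union_def restrict_def fun_eq_iff)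
    ultimately show "(t, t') \<in> (\<lambda>t. (restrict t (snd (complete_graph S)), restrict t (snd G))) ` types D U E"
      by (intro image_eqI[where x = "edge_type D U r"]) (auto simp: types_def)
  qed
  then have "real (card B) \<le> real (card (types D U E))"
    unfolding of_nat_le_iff by (rule surj_card_le[OF finU])
  moreover have "card B = (\<Sum>t\<in>good. card (types D G (Et t)))"
    unfolding B_def using finT finE G
    by (intro card_SigmaI) (auto simp: good_def Et_def intro!: finite_types)
  then have "real (card B) = (\<Sum>t\<in>good. real (card (types D G (Et t))))"
    by simp
  moreover have "real (card good) * b \<le> (\<Sum>t\<in>good. real (card (types D G (Et t))))"
    by (rule sum_bounded_below) (auto simp: good_def f_def Et_def intro!: IH)
  ultimately have "real (card good) * b \<le> real (card (types D U E))"
    by linarith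
  then have "2 * f * (real (card good) * b) \<le> 2 * f * real (card (types D U E))"
    using f0 by (intro mult_left_mono) auto
  moreover have "Q * b \<le> 2 * f * (real (card good) * b)"
    using mult_right_mono[OF good b] by (simp only: mult.assoc)
  ultimately show ?thesis
    unfolding Q_def f_def U_def by (rule order.trans[rotated])
qed

end

text \<open>The alternative \<open>card T = 1\<close> of \<open>simplex_tree\<close> is absorbed:
  these conditions hold for a single simplex as well, and removing a leaf preserves them, as the
  induction requires.\<close>

definition tree_like :: "'v set set \<Rightarrow> bool" where
  "tree_like T \<longleftrightarrow> finite T \<and> (\<forall>S\<in>T. finite S \<and> S \<noteq> {}) \<and>
     (\<forall>A\<in>T. \<forall>B\<in>T. A \<noteq> B \<longrightarrow> card (A \<inter> B) \<le> 1) \<and>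
     (\<forall>A\<in>T. \<forall>B\<in>T. \<exists>Ss. simplex_walk T Ss \<and> hd Ss = A \<and> last Ss = B) \<and>
     \<not> (\<exists>Ss. simplex_walk T Ss \<and> length Ss \<ge> 3 \<and> last Ss \<inter> hd Ss \<noteq> {})"

lemma tree_like_if_simplex_tree:
  assumes "simplex_tree T"
  shows "tree_like T"
proof (cases "card T = 1")
  case True
  then obtain S where S: "T = {S}"
    by (auto simp: card_1_singleton_iff)
  have short: "length Ss \<le> 1" if "simplex_walk T Ss" for Ss
    using that card_mono[of T "set Ss"] distinct_card[of Ss] by (simp add: simplex_walk_def S)
  have "simplex_walk T [S]"
    by (simp add: simplex_walk_def S)
  then have walk: "\<exists>Ss. simplex_walk T Ss \<and> hd Ss = S \<and> last Ss = S"
    by force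
  have "finite S" "S \<noteq> {}"
    using assms by (auto simp: S simplex_tree_def is_simplex_def)
  then show ?thesis
    using walk short unfolding tree_like_def by (fastforce simp: S)
next
  case False
  then show ?thesis
    using assms unfolding tree_like_def simplex_tree_def is_simplex_def by fastforce
qed

text \<open>The last simplex of a longest walk is a leaf.\<close>

lemma tree_like_leaf:
  assumes T: "tree_like T" and "card T \<ge> 2"
  obtains S v where "S \<in> T" "tree_like (T - {S})" "S \<inter> \<Union>(T - {S}) = {v}"
proof -
  have fin: "finite T" and acyc: "\<And>Ss. simplex_walk T Ss \<Longrightarrow> length Ss \<ge> 3 \<Longrightarrow> last Ss \<inter> hd Ss = {}"
    and conn: "\<And>A B. A \<in> T \<Longrightarrow> B \<in> T \<Longrightarrow> \<exists>Ss. simplex_walk T Ss \<and> hd Ss = A \<and> last Ss = B"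
    using T by (auto simp: tree_like_def)
  obtain A B where AB: "A \<in> T" "B \<in> T" "A \<noteq> B"
    using assms(2) fin by (meson card_2_iff' obtain_subset_with_card_n subset_iff)
  then obtain Ss where Ss: "simplex_walk T Ss" "hd Ss = A" "last Ss = B"
    using conn by blast
  have "length Ss \<ge> 2"
    using Ss AB(3) by (cases Ss rule: remdups_adj.cases) (auto simp: simplex_walk_def)
  have "length Ss \<le> card T" if "simplex_walk T Ss" for Ss
    using that card_mono[OF fin, of "set Ss"] distinct_card[of Ss] by (simp add: simplex_walk_def)
  then have "\<exists>W. simplex_walk T W \<and> (\<forall>Ss. simplex_walk T Ss \<longrightarrow> length Ss \<le> length W)"
    by (intro ex_has_greatest_nat[where k = Ss and b = "Suc (card T)"] Ss(1)) (auto simp: le_imp_less_Suc)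
  then obtain W where W: "simplex_walk T W" "\<And>Ss. simplex_walk T Ss \<Longrightarrow> length Ss \<le> length W"
    by auto
  have "length W \<ge> 2"
    using W(2)[OF Ss(1)] \<open>length Ss \<ge> 2\<close> by simp
  then obtain ws N S where W_eq: "W = ws @ [N, S]"
    by (cases W rule: rev_cases; cases "butlast W" rule: rev_cases) auto
  have S: "S \<in> T" "N \<in> T" "N \<noteq> S" "N \<inter> S \<noteq> {}"
    using W(1) by (auto simp: W_eq simplex_walk_def successively_append_iff)
  \<comment> \<open>Another simplex \<open>C\<close> meeting the end \<open>S\<close> would prolong
    the longest walk or, if already on it, close a cycle from \<open>C\<close> through
    \<open>N\<close> to \<open>S\<close>.\<close>
  have nbr: "C = N" if C: "C \<in> T" "C \<noteq> S" "C \<inter> S \<noteq> {}" for C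
  proof (rule ccontr)
    assume "C \<noteq> N"
    have "C \<in> set W"
    proof (rule ccontr)
      assume "C \<notin> set W"
      then have "simplex_walk T (W @ [C])"
        using W(1) C by (auto simp: W_eq simplex_walk_def successively_append_iff)
      from W(2)[OF this] show False by simp
    qed
    then have "C \<in> set ws"
      using \<open>C \<noteq> N\<close> C(2) by (auto simp: W_eq)
    then obtain us vs where "ws = us @ C # vs"
      using split_list by fast
    then have "simplex_walk T (C # vs @ [N, S])"
      using W(1) by (auto simp: W_eq simplex_walk_def successively_append_iff)
    from acyc[OF this] C(3) show False by auto
  qed
  have "card (N \<inter> S) \<le> 1" "finite (N \<inter> S)"
    using T S by (auto simp: tree_like_def)
  then obtain v where v: "N \<inter> S = {v}"
    using S(4) by (metis One_nat_def card_1_singletonE card_gt_0_iff le_antisym Suc_leI)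
  have "S \<inter> \<Union>(T - {S}) = {v}"
    using v S nbr by blast
  moreover have "tree_like (T - {S})"
    unfolding tree_like_def
  proof (intro conjI ballI)
    fix A B assume AB: "A \<in> T - {S}" "B \<in> T - {S}"
    then obtain Ss where Ss: "simplex_walk T Ss" "hd Ss = A" "last Ss = B"
      using conn by blast
    \<comment> \<open>The ends of the walk differ from \<open>S\<close>, so an occurrence of
      \<open>S\<close> would have neighbours on both sides. Both would be \<open>N\<close>, but
      walks do not repeat simplices.\<close>
    have "S \<notin> set Ss"
    proof
      assume "S \<in> set Ss"
      then obtain us vs where split: "Ss = us @ S # vs"
        by (auto dest: split_list)
      have ne: "us \<noteq> []" "vs \<noteq> []"
        using AB Ss split by auto
      have "last us \<in> T" "last us \<noteq> S" "last us \<inter> S \<noteq> {}" "hd vs \<in> T" "hd vs \<noteq> S" "hd vs \<inter> S \<noteq> {}"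
        using Ss(1) ne subsetD[OF _ last_in_set[OF ne(1)]] subsetD[OF _ hd_in_set[OF ne(2)]]
          last_in_set[OF ne(1)] hd_in_set[OF ne(2)]
        by (auto simp: split simplex_walk_def successively_append_iff successively_Cons)
      then have "last us = hd vs"
        using nbr by metis
      then show False
        using Ss(1) ne last_in_set[OF ne(1)] hd_in_set[OF ne(2)]
        by (auto simp: split simplex_walk_def)
    qed
    then show "\<exists>Ss. simplex_walk (T - {S}) Ss \<and> hd Ss = A \<and> last Ss = B"
      using Ss by (intro exI[of _ Ss]) (auto simp: simplex_walk_def)
  next
    show "\<not> (\<exists>Ss. simplex_walk (T - {S}) Ss \<and> length Ss \<ge> 3 \<and> last Ss \<inter> hd Ss \<noteq> {})"
      using acyc unfolding simplex_walk_def by blast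
  qed (use T in \<open>auto simp: tree_like_def\<close>)
  ultimately show ?thesis
    using that S(1) by blast
qed

text \<open>The constants are fixed before the space and the set. The constant \<open>C\<close>
  leaves room for passing to subsets of \<open>E\<close>, since the induction hypothesis is applied
  to the points available at the attaching vertex.\<close>

lemma card_types_simplex_tree_ge:
  assumes "tree_like T" "\<forall>S\<in>T. card S \<le> Suc n"
  shows "\<exists>C\<ge>1. \<exists>c>0. \<forall>(V :: 'p set) (K :: 'k set) D E.
    bisector_space V K D \<and> E \<subseteq> V \<and> E \<noteq> {} \<and>
    C * real (card V) * real (card K) ^ (2 * n) \<le> (real (card E))\<^sup>2 * real (card K) \<longrightarrow>
    c * real (card (types D (union_graph T) V)) \<le> real (card (types D (union_graph T) E))"
  using assms
proof (induction "card T" arbitrary: T rule: less_induct)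
  case less
  have finT: "finite T" and T: "\<And>S. S \<in> T \<Longrightarrow> finite S \<and> S \<noteq> {}"
    using less.prems by (auto simp: tree_like_def)
  consider "card T = 0" | "card T = 1" | "card T \<ge> 2"
    by linarith
  then show ?case
  proof cases
    case 1
    then have "T = {}"
      using finT by simp
    then show ?thesis
      by (intro exI[of _ 1] conjI allI impI) (auto simp: types_def union_graph_def)
  next
    case 2
    then obtain S where S: "T = {S}"
      by (auto simp: card_1_singleton_iff)
    show ?thesis
    proof (rule exI[of _ 1], intro exI[of _ "1 / fact (card S)"] conjI allI impI)
      fix V :: "'p set" and K :: "'k set" and D E
      assume *: "bisector_space V K D \<and> E \<subseteq> V \<and> E \<noteq> {} \<and>
        1 * real (card V) * real (card K) ^ (2 * n) \<le> (real (card E))\<^sup>2 * real (card K)"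
      then interpret bisector_space V K D by simp
      have "real (card (types D (complete_graph S) V)) \<le> q ^ (card S choose 2)"
        using S T by (intro card_types_complete_graph_le) auto
      also have "\<dots> \<le> fact (card S) * real (card (types D (complete_graph S) E))"
        using * S T less.prems by (intro card_types_simplex_ge[where n = n]) (auto simp: q_def)
      finally show "1 / fact (card S) * real (card (types D (union_graph T) V)) \<le>
          real (card (types D (union_graph T) E))"
        by (simp add: S union_graph_singleton field_simps)
    qed auto
  next
    case 3
    obtain S v where S: "S \<in> T" "tree_like (T - {S})" "S \<inter> \<Union>(T - {S}) = {v}"
      using tree_like_leaf[OF less.prems(1) 3] .
    define G where "G = union_graph (T - {S})"
    have "card (T - {S}) < card T"
      using finT S by (intro psubset_card_mono) auto
    from less.hyps[OF this S(2)] less.prems(2) obtain C c where C: "C \<ge> 1" and c: "c > 0"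
      and IH: "\<And>(V :: 'p set) (K :: 'k set) D E. bisector_space V K D \<Longrightarrow> E \<subseteq> V \<Longrightarrow> E \<noteq> {} \<Longrightarrow>
        C * real (card V) * real (card K) ^ (2 * n) \<le> (real (card E))\<^sup>2 * real (card K) \<Longrightarrow>
        c * real (card (types D G V)) \<le> real (card (types D G E))"
      unfolding G_def by auto
    define k :: real where "k = 2 * fact (card S)"
    have k1: "k \<ge> 1"
      unfolding k_def using fact_ge_1[of "card S", where 'a = real] by linarith
    have UG: "union_graph T = graph_union G (complete_graph S)"
      using S(1) by (metis G_def insert_Diff union_graph_insert)
    have G: "finite (fst G)" "snd G \<subseteq> fst G \<times> fst G" "S \<inter> fst G = {v}"
      using finT T S(3) edges_union_graph[of "T - {S}"] by (auto simp: G_def fst_union_graph)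
    have finS: "finite S" "card S \<le> Suc n"
      using S(1) T less.prems by auto
    show ?thesis
    \<comment> \<open>The size condition is quadratic in \<open>card E\<close>, so if
      \<open>E\<close> satisfies it with \<open>C * k^2\<close>, then a subset of at least
      \<open>card E / k\<close> points satisfies it with \<open>C\<close>. The attached simplex
      costs a factor \<open>1 / k\<close> in the proportion.\<close>
    proof (rule exI[of _ "C * k\<^sup>2"], intro exI[of _ "c / k"] conjI allI impI)
      show "1 \<le> C * k\<^sup>2"
        using C k1 by (metis mult_mono' one_le_power mult_1 zero_le_one)
      show "0 < c / k"
        using c k1 by simp
      fix V :: "'p set" and K :: "'k set" and D E
      assume *: "bisector_space V K D \<and> E \<subseteq> V \<and> E \<noteq> {} \<and>
        C * k\<^sup>2 * real (card V) * real (card K) ^ (2 * n) \<le> (real (card E))\<^sup>2 * real (card K)"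
      then interpret bisector_space V K D by simp
      define b where "b = c * real (card (types D G V))"
      have finE: "finite E"
        using * finite_subset_V by auto
      have large: "C * real (card V) * q ^ (2 * n) \<le> (real (card E'))\<^sup>2 * q"
        if "real (card E) \<le> k * real (card E')" for E' :: "'p set"
      proof -
        have "k\<^sup>2 * (C * real (card V) * q ^ (2 * n)) \<le> (real (card E))\<^sup>2 * q"
          using * by (simp add: q_def mult_ac)
        also have "\<dots> \<le> (k * real (card E'))\<^sup>2 * q"
          using that q_ge_1 by (intro mult_right_mono power_mono) auto
        finally show ?thesis
          using k1 by (simp add: power_mult_distrib)
      qed
      have "real (card V) * q ^ (2 * n) \<le> C * real (card V) * q ^ (2 * n)"
        unfolding mult.assoc using mult_right_mono[OF C, of "real (card V) * q ^ (2 * n)"] q_ge_1 by simp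
      also have "\<dots> \<le> (real (card E))\<^sup>2 * q"
        using k1 by (intro large) (simp add: mult_le_cancel_right1)
      finally have E: "real (card V) * q ^ (2 * n) \<le> (real (card E))\<^sup>2 * q" .
      have "q ^ (card S choose 2) * b \<le>
          2 * fact (card S) * real (card (types D (graph_union G (complete_graph S)) E))"
      proof (rule card_types_attach_simplex_ge[OF _ _ E finS G])
        fix E' assume E': "E' \<subseteq> E" "real (card E) \<le> 2 * fact (card S) * real (card E')"
        have "E' \<noteq> {}"
          using E'(2) * finE by auto
        then show "b \<le> real (card (types D G E'))"
          unfolding b_def using E' * large[of E']
          by (intro IH[where K = K]) (auto simp: k_def q_def)
      qed (use * c in \<open>auto simp: b_def\<close>)
      then have lower: "q ^ (card S choose 2) * b \<le> k * real (card (types D (union_graph T) E))"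
        by (simp add: k_def UG)
      have "real (card (types D (union_graph T) V)) \<le>
          real (card (types D G V) * card (types D (complete_graph S) V))"
        unfolding UG of_nat_le_iff using G finS edges_complete_graph[of S] finite_V
        by (intro card_types_graph_union_le) auto
      also have "\<dots> \<le> real (card (types D G V)) * q ^ (card S choose 2)"
        using card_types_complete_graph_le[OF finS(1)] by (simp add: mult_left_mono)
      finally have "c * real (card (types D (union_graph T) V)) \<le> q ^ (card S choose 2) * b"
        using c by (simp add: b_def mult_left_mono mult_ac)
      with lower show "c / k * real (card (types D (union_graph T) V)) \<le>
          real (card (types D (union_graph T) E))"
        using k1 by (simp add: field_simps)
    qed
  qed
qed

section \<open>Finite fields\<close>

text \<open>Otherwise \<open>{\<zero>, \<one>}\<close> would be an additive subgroup of order two,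
  which Lagrange's theorem excludes in odd order.\<close>

lemma (in field) two_neq_zero:
  assumes "finite (carrier R)" "odd (card (carrier R))"
  shows "\<one> \<oplus> \<one> \<noteq> \<zero>"
proof
  assume two: "\<one> \<oplus> \<one> = \<zero>"
  then have "subgroup {\<zero>, \<one>} (add_monoid R)"
    using add.inv_equality[of \<one> \<one>] by (intro add.subgroupI) (auto simp: a_inv_def)
  then have "card (carrier (add_monoid R)) = card (rcosets\<^bsub>add_monoid R\<^esub> {\<zero>, \<one>}) * card {\<zero>, \<one>}"
    using assms(1) add.lagrange_finite[of "{\<zero>, \<one>}"] by (simp add: order_def)
  then show False
    using assms(2) by simp
qed

lemma (in ring) minus_eq_zero_iff:
  assumes "x \<in> carrier R" "y \<in> carrier R"
  shows "x \<ominus> y = \<zero> \<longleftrightarrow> x = y"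
proof
  assume "x \<ominus> y = \<zero>"
  moreover have "x = (x \<ominus> y) \<oplus> y"
    using assms by algebra
  ultimately show "x = y"
    using assms by simp
qed (use assms in \<open>simp add: minus_eq r_neg\<close>)

text \<open>\<open>P\<close> and \<open>Q\<close> stand for the contributions of the other
  coordinates. Subtraction cancels the square of the unknown and leaves a linear equation, which
  determines the coordinate because 2 and \<open>t \<ominus> s\<close> are invertible.\<close>

lemma (in field) eq_if_equidistant_twice:
  assumes "\<one> \<oplus> \<one> \<noteq> \<zero>" "s \<noteq> t"
    and car: "a \<in> carrier R" "b \<in> carrier R" "s \<in> carrier R" "t \<in> carrier R"
      "P \<in> carrier R" "Q \<in> carrier R"
    and a: "(a \<ominus> s) \<otimes> (a \<ominus> s) \<oplus> P = (a \<ominus> t) \<otimes> (a \<ominus> t) \<oplus> Q"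
    and b: "(b \<ominus> s) \<otimes> (b \<ominus> s) \<oplus> P = (b \<ominus> t) \<otimes> (b \<ominus> t) \<oplus> Q"
  shows "a = b"
proof -
  have factor: "(t \<ominus> s) \<otimes> ((x \<oplus> x) \<ominus> (s \<oplus> t)) = Q \<ominus> P"
    if "x \<in> carrier R" "(x \<ominus> s) \<otimes> (x \<ominus> s) \<oplus> P = (x \<ominus> t) \<otimes> (x \<ominus> t) \<oplus> Q" for x
  proof -
    define X Y where "X = (x \<ominus> s) \<otimes> (x \<ominus> s)" and "Y = (x \<ominus> t) \<otimes> (x \<ominus> t)"
    have XY: "X \<in> carrier R" "Y \<in> carrier R"
      using that car by (auto simp: X_def Y_def)
    have "(t \<ominus> s) \<otimes> ((x \<oplus> x) \<ominus> (s \<oplus> t)) = X \<ominus> Y"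
      unfolding X_def Y_def using that(1) car(3,4) by algebra
    also have "\<dots> = (X \<oplus> P) \<ominus> (Y \<oplus> P)"
      using XY car(5) by algebra
    also have "\<dots> = (Y \<oplus> Q) \<ominus> (Y \<oplus> P)"
      using that(2) by (simp add: X_def Y_def)
    also have "\<dots> = Q \<ominus> P"
      using XY car(5,6) by algebra
    finally show ?thesis .
  qed
  have "t \<ominus> s \<noteq> \<zero>"
    using assms(2) car by (auto simp: minus_eq_zero_iff)
  moreover have "(t \<ominus> s) \<otimes> ((a \<oplus> a) \<ominus> (s \<oplus> t)) = (t \<ominus> s) \<otimes> ((b \<oplus> b) \<ominus> (s \<oplus> t))"
    using factor[OF car(1) a] factor[OF car(2) b] by simp
  ultimately have eq: "(a \<oplus> a) \<ominus> (s \<oplus> t) = (b \<oplus> b) \<ominus> (s \<oplus> t)"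
    using car by (simp add: m_lcancel)
  have "(\<one> \<oplus> \<one>) \<otimes> (a \<ominus> b) = (a \<oplus> a) \<ominus> (b \<oplus> b)"
    using car(1,2) by algebra
  also have "\<dots> = ((a \<oplus> a) \<ominus> (s \<oplus> t)) \<ominus> ((b \<oplus> b) \<ominus> (s \<oplus> t))"
    using car(1-4) by algebra
  also have "\<dots> = \<zero>"
    unfolding eq using car by (simp add: minus_eq_zero_iff)
  finally show ?thesis
    using assms(1) car by (auto simp: integral_iff minus_eq_zero_iff)
qed

section \<open>Squared distances and bisectors in affine space\<close>

lemma affine_space_nth: "x \<in> affine_space F d \<Longrightarrow> i < d \<Longrightarrow> x i \<in> carrier F"
  by (auto simp: affine_space_def)

lemma sqdist_closed:
  fixes R :: "'a ring" (structure)
  assumes "cring R" "x \<in> affine_space R d" "y \<in> affine_space R d"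
  shows "sqdist R d x y \<in> carrier R"
proof -
  interpret cring R by fact
  show ?thesis
    using assms unfolding sqdist_def affine_space_def by (intro finsum_closed) auto
qed

lemma sqdist_sym:
  fixes R :: "'a ring" (structure)
  assumes "cring R" "x \<in> affine_space R d" "y \<in> affine_space R d"
  shows "sqdist R d x y = sqdist R d y x"
proof -
  interpret cring R by fact
  have "(x i \<ominus> y i) [^] (2::nat) = (y i \<ominus> x i) [^] (2::nat)" if "i < d" for i
  proof -
    have "x i \<in> carrier R" "y i \<in> carrier R"
      using assms that by (auto simp: affine_space_def)
    then show ?thesis
      unfolding numeral_2_eq_2 nat_pow_Suc nat_pow_0 by algebra
  qed
  then show ?thesis
    unfolding sqdist_def using affine_space_nth[OF assms(2)] affine_space_nth[OF assms(3)]
    by (intro finsum_cong') auto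
qed

lemma sqdist_split:
  fixes R :: "'a ring" (structure)
  assumes "cring R" "x \<in> affine_space R d" "y \<in> affine_space R d" "j < d"
  shows "sqdist R d x y = (x j \<ominus> y j) \<otimes> (x j \<ominus> y j) \<oplus>
    (\<Oplus>i\<in>{..<d} - {j}. (x i \<ominus> y i) [^] (2::nat))"
proof -
  interpret cring R by fact
  note nth = affine_space_nth[OF assms(2)] affine_space_nth[OF assms(3)]
  have "{..<d} = insert j ({..<d} - {j})"
    using assms by auto
  then have "sqdist R d x y = (\<Oplus>i\<in>insert j ({..<d} - {j}). (x i \<ominus> y i) [^] (2::nat))"
    by (simp add: sqdist_def)
  also have "\<dots> = (x j \<ominus> y j) [^] (2::nat) \<oplus> (\<Oplus>i\<in>{..<d} - {j}. (x i \<ominus> y i) [^] (2::nat))"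
    using assms(4) nth by (intro finsum_insert) auto
  finally show ?thesis
    using assms(4) nth by (simp add: numeral_2_eq_2)
qed

text \<open>Distinct points differ in some coordinate \<open>j\<close>, and on their bisector the
  other coordinates determine the \<open>j\<close>-th. So the bisector has at most q^(d-1)
  points.\<close>

lemma bisector_space_affine_space:
  fixes R :: "'a ring" (structure)
  assumes "field R" "finite (carrier R)" "odd (card (carrier R))"
  shows "bisector_space (affine_space R d) (carrier R) (sqdist R d)"
proof -
  interpret field R by fact
  show ?thesis
  proof
    show "finite (affine_space R d)"
      unfolding affine_space_def using assms by (intro finite_PiE) auto
    show "carrier R \<noteq> {}"
      by auto
    fix u w assume uw: "u \<in> affine_space R d" "w \<in> affine_space R d" "u \<noteq> w"
    then obtain j where j: "j < d" "u j \<noteq> w j"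
      unfolding affine_space_def by (metis PiE_ext lessThan_iff)
    define B where "B = {x \<in> affine_space R d. sqdist R d x u = sqdist R d x w}"
    let ?I = "{..<d} - {j}"
    have "inj_on (\<lambda>x. restrict x ?I) B"
    proof (rule inj_onI)
      fix x y assume xy: "x \<in> B" "y \<in> B" and eq: "restrict x ?I = restrict y ?I"
      then have aff: "x \<in> affine_space R d" "y \<in> affine_space R d"
        by (auto simp: B_def)
      have off_j: "x i = y i" if "i \<in> ?I" for i
        using fun_cong[OF eq, of i] that by simp
      define P where "P v = (\<Oplus>i\<in>?I. (x i \<ominus> v i) [^] (2::nat))" for v
      note nth = affine_space_nth[OF aff(1)] affine_space_nth[OF aff(2)]
        affine_space_nth[OF uw(1)] affine_space_nth[OF uw(2)]
      have Py: "P v = (\<Oplus>i\<in>?I. (y i \<ominus> v i) [^] (2::nat))" if "v \<in> affine_space R d" for v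
        unfolding P_def using off_j nth affine_space_nth[OF that] by (intro finsum_cong') auto
      have P: "P u \<in> carrier R" "P w \<in> carrier R"
        unfolding P_def using nth by (auto intro!: finsum_closed)
      have car: "x j \<in> carrier R" "y j \<in> carrier R" "u j \<in> carrier R" "w j \<in> carrier R"
        using nth j by auto
      have eqx: "(x j \<ominus> u j) \<otimes> (x j \<ominus> u j) \<oplus> P u = (x j \<ominus> w j) \<otimes> (x j \<ominus> w j) \<oplus> P w"
        using xy sqdist_split[OF is_cring aff(1) uw(1) j(1)] sqdist_split[OF is_cring aff(1) uw(2) j(1)]
        by (simp add: B_def P_def)
      have eqy: "(y j \<ominus> u j) \<otimes> (y j \<ominus> u j) \<oplus> P u = (y j \<ominus> w j) \<otimes> (y j \<ominus> w j) \<oplus> P w"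
        using xy sqdist_split[OF is_cring aff(2) uw(1) j(1)] sqdist_split[OF is_cring aff(2) uw(2) j(1)]
        by (simp add: B_def Py uw)
      have "x j = y j"
        by (rule eq_if_equidistant_twice[OF two_neq_zero[OF assms(2,3)] j(2) car P eqx eqy])
      then have "x i = y i" if "i < d" for i
        using off_j that by (cases "i = j") auto
      then show "x = y"
        using aff unfolding affine_space_def by (metis PiE_ext lessThan_iff)
    qed
    moreover have "(\<lambda>x. restrict x ?I) ` B \<subseteq> ?I \<rightarrow>\<^sub>E carrier R"
      by (auto simp: B_def affine_space_def PiE_iff split: if_splits)
    ultimately have "card B \<le> card (?I \<rightarrow>\<^sub>E carrier R)"
      using assms by (intro card_inj_on_le finite_PiE) auto
    also have "\<dots> = card (carrier R) ^ (d - 1)"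
      using j by (simp add: card_funcsetE)
    finally have "card (carrier R) * card B \<le> card (carrier R) ^ Suc (d - 1)"
      by simp
    also have "\<dots> = card (affine_space R d)"
      using j by (simp add: affine_space_def card_funcsetE)
    finally show "card (carrier R) * card {x \<in> affine_space R d. sqdist R d x u = sqdist R d x w}
        \<le> card (affine_space R d)"
      by (simp add: B_def)
  qed (use assms sqdist_closed[OF is_cring] sqdist_sym[OF is_cring] in auto)
qed

text \<open>The class map and the type map have the same fibres on the embeddings into
  \<open>E\<close>, and both sides count their images.\<close>

lemma card_congruence_classes_in:
  assumes "finite (carrier F)" "finite (fst G)" "E \<subseteq> affine_space F d"
  shows "card (congruence_classes_in F d G E) = card (types (sqdist F d) G E)"
proof -
  let ?class = "\<lambda>p. congruence F d G `` {p}" and ?A = "fst G \<rightarrow>\<^sub>E E"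
  have sub: "?A \<subseteq> embeddings F d G"
    unfolding embeddings_def using assms(3) by (intro PiE_mono) auto
  have classes: "congruence_classes_in F d G E = ?class ` ?A"
  proof (intro equalityI subsetI)
    fix c assume "c \<in> congruence_classes_in F d G E"
    then obtain p where p: "c \<in> embeddings F d G // congruence F d G" "p \<in> c" "p ` fst G \<subseteq> E"
      by (auto simp: congruence_classes_in_def congruence_classes_def)
    have "p \<in> embeddings F d G"
      using p in_quotient_imp_subset[OF equiv_congruence[of F d G]] by blast
    then have "p \<in> ?A"
      using p(3) by (auto simp: embeddings_def PiE_iff)
    moreover obtain p' where p': "c = ?class p'"
      using p(1) by (rule quotientE)
    then have "c = ?class p"
      using p(2) equiv_class_eq[OF equiv_congruence[of F d G], of p' p] by simp
    ultimately show "c \<in> ?class ` ?A"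
      by blast
  next
    fix c assume "c \<in> ?class ` ?A"
    then obtain p where "p \<in> ?A" "c = ?class p"
      by auto
    moreover from this have "p \<in> embeddings F d G" "p ` fst G \<subseteq> E"
      using sub by auto
    ultimately show "c \<in> congruence_classes_in F d G E"
      using equiv_class_self[OF equiv_congruence[of F d G], of p]
      by (auto simp: congruence_classes_in_def congruence_classes_def intro!: quotientI bexI[of _ p])
  qed
  have iff: "?class p = ?class p' \<longleftrightarrow> edge_type (sqdist F d) G p = edge_type (sqdist F d) G p'"
    if "p \<in> ?A" "p' \<in> ?A" for p p'
    using that sub eq_equiv_class_iff[OF equiv_congruence, of p F d G p']
    by (auto simp: congruence_def edge_type_eq_iff subset_iff)
  have fin: "finite ?A"
    using assms by (intro finite_PiE) (auto intro: finite_subset simp: affine_space_def finite_PiE)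
  show ?thesis
    unfolding types_def classes
    by (rule antisym) (rule card_image_le_card_image[OF fin], simp only: iff)+
qed

lemma congruence_classes_eq:
  "congruence_classes F d G = congruence_classes_in F d G (affine_space F d)"
proof -
  have "\<exists>p\<in>c. p ` fst G \<subseteq> affine_space F d" if "c \<in> congruence_classes F d G" for c
  proof -
    have "c \<noteq> {}" "c \<subseteq> embeddings F d G"
      using that in_quotient_imp_non_empty[OF equiv_congruence[of F d G]]
        in_quotient_imp_subset[OF equiv_congruence[of F d G]]
      unfolding congruence_classes_def by blast+
    then show ?thesis
      by (fastforce simp: embeddings_def)
  qed
  then show ?thesis
    by (auto simp: congruence_classes_in_def)
qed

theorem theorem1p6:
  fixes d n :: nat and T :: "'v set set"
  assumes "d \<ge> 2"
    and "simplex_tree T"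
    and "\<forall>S\<in>T. \<exists>k\<le>n. is_simplex k S"
    and "real n < (real d + 1) / 2"
  shows "\<exists>(C::real)>0. \<exists>(c::real)>0. \<forall>(F :: 'a ring) E.
    field F \<and> finite (carrier F) \<and> odd (card (carrier F)) \<and>
    E \<subseteq> affine_space F d \<and>
    real (card E) \<ge> C * real (card (carrier F)) powr (real n + (real d - 1) / 2) \<longrightarrow>
    real (card (congruence_classes_in F d (union_graph T) E))
      \<ge> c * real (card (congruence_classes F d (union_graph T)))"
proof -
  let ?G = "union_graph T"
  have T: "tree_like T" "\<forall>S\<in>T. card S \<le> Suc n"
    using assms tree_like_if_simplex_tree by (auto simp: is_simplex_def)
  obtain C c :: real where C: "C \<ge> 1" and c: "c > 0"
    and main: "\<And>(V :: (nat \<Rightarrow> 'a) set) (K :: 'a set) D E. bisector_space V K D \<Longrightarrow> E \<subseteq> V \<Longrightarrow> E \<noteq> {} \<Longrightarrow>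
      C * real (card V) * real (card K) ^ (2 * n) \<le> (real (card E))\<^sup>2 * real (card K) \<Longrightarrow>
      c * real (card (types D ?G V)) \<le> real (card (types D ?G E))"
    using card_types_simplex_tree_ge[OF T, where 'p = "nat \<Rightarrow> 'a" and 'k = 'a] by auto
  show ?thesis
  \<comment> \<open>The size condition of the abstract result concerns the square of
    \<open>card E\<close>, hence the root.\<close>
  proof (rule exI[of _ "sqrt C"], intro exI[of _ c] conjI allI impI)
    fix F :: "'a ring" and E
    assume *: "field F \<and> finite (carrier F) \<and> odd (card (carrier F)) \<and> E \<subseteq> affine_space F d \<and>
      real (card E) \<ge> sqrt C * real (card (carrier F)) powr (real n + (real d - 1) / 2)"
    then interpret field F by simp
    define q where "q = real (card (carrier F))"
    have q0: "q > 0"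
      using * by (auto simp: q_def card_gt_0_iff)
    have large: "sqrt C * q powr (real n + (real d - 1) / 2) \<le> real (card E)"
      using * by (simp add: q_def)
    moreover have "sqrt C * q powr (real n + (real d - 1) / 2) > 0"
      using C q0 by simp
    ultimately have ne: "E \<noteq> {}"
      by auto
    have finG: "finite (fst ?G)"
      using T by (auto simp: fst_union_graph tree_like_def)
    have cardV: "real (card (affine_space F d)) = q ^ d"
      by (simp add: affine_space_def card_funcsetE q_def)
    have powr_double_Suc: "q powr (2 * e + 1) = (q powr e)\<^sup>2 * q" for e
      unfolding mult_2 powr_add power2_eq_square using q0 by simp
    \<comment> \<open>With \<open>s\<close> the exponent in the hypothesis on \<open>E\<close>,
      \<open>2s + 1 = d + 2n\<close>: squaring the hypothesis and multiplying by \<open>q\<close>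
      yields the size condition, as the space has q^d points.\<close>
    have exponent: "2 * (real n + (real d - 1) / 2) + 1 = real d + real (2 * n)"
      by (simp add: field_simps)
    have "C * q ^ d * q ^ (2 * n) = C * q powr (2 * (real n + (real d - 1) / 2) + 1)"
      unfolding exponent powr_add powr_realpow[OF q0] by simp
    also have "q powr (2 * (real n + (real d - 1) / 2) + 1) = (q powr (real n + (real d - 1) / 2))\<^sup>2 * q"
      by (rule powr_double_Suc)
    also have "C * ((q powr (real n + (real d - 1) / 2))\<^sup>2 * q) =
        (sqrt C * q powr (real n + (real d - 1) / 2))\<^sup>2 * q"
      using C by (simp add: power_mult_distrib)
    also have "\<dots> \<le> (real (card E))\<^sup>2 * q"
      using large q0 C by (intro mult_right_mono power_mono) auto
    finally have "C * real (card (affine_space F d)) * real (card (carrier F)) ^ (2 * n)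
        \<le> (real (card E))\<^sup>2 * real (card (carrier F))"
      unfolding cardV by (simp add: q_def)
    then have "c * real (card (types (sqdist F d) ?G (affine_space F d))) \<le>
        real (card (types (sqdist F d) ?G E))"
      using * ne by (intro main[OF bisector_space_affine_space[OF field_axioms]]) auto
    then show "real (card (congruence_classes_in F d ?G E)) \<ge> c * real (card (congruence_classes F d ?G))"
      using * finG by (simp add: congruence_classes_eq card_congruence_classes_in)
  qed (use C c in auto)
qed

end
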